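(* For all positive integers $m$ and $p$: $$W(2p+2m-1,2m)=2(-1)^m\sum_{j=0}^{p-1}\bar\zeta(2p-2-2j)\sum_{n=1}^\infty\frac{T_n(\{1\}_{2m-1})T_n(\{1\}_{2j+1})}{n}(-1)^n,$$ $$W(2p+2m-2,2m)=2(-1)^m\sum_{j=0}^{p-2}\bar\zeta(2p-3-2j)\sum_{n=1}^\infty\frac{T_n(\{1\}_{2m-1})T_n(\{1\}_{2j+1})}{n}(-1)^n+(-1)^m\sum_{n=1}^\infty\frac{T_n(\{1\}_{2m-1})S_n(\{1\}_{2p-2})}{n}(-1)^n,$$ $$W(2p+2m-2,2m-1)=4(-1)^{m-1}\sum_{j=0}^{p-1}\bar\zeta(2p-1-2j)\sum_{n=1}^\infty\frac{T_n(\{1\}_{2m-2})T_n(\{1\}_{2j})}{2n-1}(-1)^n+2(-1)^{m-1}\sum_{n=1}^\infty\frac{T_n(\{1\}_{2m-2})S_n(\{1\}_{2p-1})}{2n-1}(-1)^n,$$ $$W(2p+2m-3,2m-1)=4(-1)^{m-1}\sum_{j=0}^{p-1}\bar\zeta(2p-2-2j)\sum_{n=1}^\infty\frac{T_n(\{1\}_{2m-2})T_n(\{1\}_{2j})}{2n-1}(-1)^n.$$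
   Context: $\{1\}_a$ denotes the sequence of $a$ ones. For positive integers $k_1,\dots,k_r$, $\bar T(k_1,\ldots,k_r):=2^r\sum_{0<n_1<\cdots<n_r}\frac{(-1)^{n_r}}{(2n_1-1)^{k_1}(2n_2-2)^{k_2}\cdots(2n_r-r)^{k_r}}$. $I(k,r)$ is the set of tuples $(k_1,\dots,k_r)$ of positive integers with sum $k$, and $W(k,r):=\sum_{(k_1,\dots,k_r)\in I(k,r)}\bar T(k_1,\dots,k_r)$. $\bar\zeta(s):=\sum_{n\ge1}(-1)^{n-1}n^{-s}$ for $s\ge1$, $\bar\zeta(0):=1/2$. Multiple $T$- and $S$-harmonic sums (for $n\ge1$, $a\ge1$), with $T_n(\emptyset)=S_n(\emptyset)=1$: $T_n(\{1\}_{2a-1})=\sum\frac{2^{2a-1}}{(2n_1-1)(2n_2)(2n_3-1)\cdots(2n_{2a-2})(2n_{2a-1}-1)}$ over $0<n_1\le n_2<n_3\le n_4<\cdots\le n_{2a-2}<n_{2a-1}\le n$; $T_n(\{1\}_{2a})=\sum\frac{2^{2a}}{\prod_{i=1}^a(2n_{2i-1}-1)(2n_{2i})}$ over $0<n_1\le n_2<n_3\le\cdots<n_{2a-1}\le n_{2a}<n$; $S_n(\{1\}_{2a-1})=\sum\frac{2^{2a-1}}{(2n_1)(2n_2-1)(2n_3)\cdots(2n_{2a-2}-1)(2n_{2a-1})}$ over $1\le n_1<n_2\le n_3<\cdots<n_{2a-2}\le n_{2a-1}<n$; $S_n(\{1\}_{2a})=\sum\frac{2^{2a}}{\prod_{i=1}^a(2n_{2i-1})(2n_{2i}-1)}$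 over $1\le n_1<n_2\le n_3<\cdots\le n_{2a-1}<n_{2a}\le n$ (empty sums are $0$). *)

theory Defs
  imports Complex_Main
begin

definition Tbar_partial :: "nat list \<Rightarrow> nat \<Rightarrow> real" where
  "Tbar_partial ks N =
     (\<Sum>ns \<in> {ns. length ns = length ks \<and> sorted_wrt (<) ns \<and> set ns \<subseteq> {1..N}}.
        2 ^ length ks * (-1) ^ (last ns) /
        (\<Prod>i<length ks. (2 * real (ns ! i) - real (i + 1)) ^ (ks ! i)))"

text \<open>\<open>Tbar(k_1,...,k_r)\<close> as the limit of the partial sums over \<open>n_r \<le> N\<close>
  (i.e. the iterated series, summed in the outermost index \<open>n_r\<close>).\<close>
definition Tbar :: "nat list \<Rightarrow> real" where
  "Tbar ks = lim (\<lambda>N. Tbar_partial ks N)"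

definition Iset :: "nat \<Rightarrow> nat \<Rightarrow> nat list set" where
  "Iset k r = {ks. length ks = r \<and> (\<forall>x\<in>set ks. 0 < x) \<and> sum_list ks = k}"

definition W :: "nat \<Rightarrow> nat \<Rightarrow> real" where
  "W k r = (\<Sum>ks \<in> Iset k r. Tbar ks)"

definition zetabar :: "nat \<Rightarrow> real" where
  "zetabar s = (if s = 0 then 1/2 else (\<Sum>n. (-1) ^ n / real (n + 1) ^ s))"

text \<open>Index sets for the multiple T- and S-harmonic sums \<open>T_n({1}_l)\<close>, \<open>S_n({1}_l)\<close>
  (0-based list indices: ns!i is \<open>n_{i+1}\<close>).\<close>
definition Tidx :: "nat \<Rightarrow> nat \<Rightarrow> nat list set" where
  "Tidx l n = {ns. length ns = l \<and>
      (0 < l \<longrightarrow> 0 < ns ! 0) \<and>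
      (\<forall>i. i + 1 < l \<longrightarrow> (if even i then ns ! i \<le> ns ! (i+1) else ns ! i < ns ! (i+1))) \<and>
      (0 < l \<longrightarrow> (if odd l then ns ! (l - 1) \<le> n else ns ! (l - 1) < n))}"

definition Sidx :: "nat \<Rightarrow> nat \<Rightarrow> nat list set" where
  "Sidx l n = {ns. length ns = l \<and>
      (0 < l \<longrightarrow> 0 < ns ! 0) \<and>
      (\<forall>i. i + 1 < l \<longrightarrow> (if even i then ns ! i < ns ! (i+1) else ns ! i \<le> ns ! (i+1))) \<and>
      (0 < l \<longrightarrow> (if odd l then ns ! (l - 1) < n else ns ! (l - 1) \<le> n))}"

definition Tn :: "nat \<Rightarrow> nat \<Rightarrow> real" where
  "Tn n l = (\<Sum>ns \<in> Tidx l n. 2 ^ l /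
      (\<Prod>i<l. if even i then 2 * real (ns ! i) - 1 else 2 * real (ns ! i)))"

definition Sn :: "nat \<Rightarrow> nat \<Rightarrow> real" where
  "Sn n l = (\<Sum>ns \<in> Sidx l n. 2 ^ l /
      (\<Prod>i<l. if even i then 2 * real (ns ! i) else 2 * real (ns ! i) - 1))"

end

theory Submission
  imports Defs "HOL-Analysis.Analysis" "HOL-Real_Asymp.Real_Asymp"
begin

text \<open>Put \<open>q = k - r\<close>. Inserting \<open>t ^ (2 * n\<^sub>r - r)\<close> into the series for \<open>W k r\<close> gives functions of \<open>t\<close>
  obeying a first-order linear system; solving it shows that, up to the sign \<open>(-1) ^ r\<close>, \<open>W k r\<close> is the integral
  over \<open>[0, 1]\<close> of \<open>(- ln t) ^ q / q!\<close> against \<open>- d ((\<pi> / 2 - 2 * arctan t) ^ r / r!)\<close>. In terms of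
  \<open>u = (1 - t) / (1 + t)\<close> the two factors are \<open>ln ((1 + u) / (1 - u)) ^ q / q!\<close> and
  \<open>d ((2 * arctan u) ^ r / r!)\<close>.
  The power series of the second factor has the T-harmonic sums as coefficients. The moments
  \<open>J\<^sub>q N\<close> of the first factor satisfy \<open>J\<^sub>q (N + 2) = J\<^sub>q N + 2 / (N + 1) * J\<^bsub>q-1\<^esub> (N + 1)\<close> with
  \<open>J\<^sub>q 0 = 0\<close> and \<open>J\<^sub>q 1 = 2 * zetabar q\<close> for \<open>q \<ge> 1\<close>; the T- and S-harmonic sums
  obey the same recursion, so \<open>J\<^sub>q N\<close> is a combination of them with values of \<open>zetabar\<close> as coefficients.\<close>

section \<open>Finite sums and divided powers\<close>

lemma sum_UN_image:
  assumes "finite M" and "\<And>m. m \<in> M \<Longrightarrow> finite (A m)"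
    and "inj_on (\<lambda>(m, x). h m x) (Sigma M A)"
  shows "(\<Sum>y\<in>(\<Union>m\<in>M. h m ` A m). f y) = (\<Sum>m\<in>M. \<Sum>x\<in>A m. f (h m x))"
proof -
  have "(\<Union>m\<in>M. h m ` A m) = (\<lambda>(m, x). h m x) ` Sigma M A" by force
  then show ?thesis
    using assms by (simp add: sum.reindex sum.Sigma case_prod_unfold)
qed

primrec lag :: "(nat \<Rightarrow> 'a::zero) \<Rightarrow> nat \<Rightarrow> 'a" where
  "lag f 0 = 0"
| "lag f (Suc n) = f n"

lemma sum_lag_times:
  fixes f g :: "nat \<Rightarrow> 'a::semiring_0"
  shows "(\<Sum>i\<le>n. lag f i * g (n - i)) = (\<Sum>i\<le>n. f i * lag g (n - i))"
proof (cases n)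
  case (Suc m)
  have "(\<Sum>i\<le>n. lag f i * g (n - i)) = (\<Sum>i\<le>m. f i * g (m - i))"
    unfolding Suc by (subst sum.atMost_Suc_shift) simp
  also have "\<dots> = (\<Sum>i\<le>n. f i * lag g (n - i))"
    unfolding Suc by (simp add: Suc_diff_le)
  finally show ?thesis .
qed simp

lemma has_real_derivative_convolution:
  fixes f e :: "nat \<Rightarrow> real \<Rightarrow> real"
  assumes f: "\<And>i. (f i has_real_derivative (p * lag (\<lambda>i. f i t) i + g i)) (at t)"
    and e: "\<And>i. (e i has_real_derivative - (p * lag (\<lambda>i. e i t) i)) (at t)"
  shows "((\<lambda>t. \<Sum>i\<le>n. f i t * e (n - i) t) has_real_derivative (\<Sum>i\<le>n. g i * e (n - i) t)) (at t)"
proof -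
  have "((\<lambda>t. \<Sum>i\<le>n. f i t * e (n - i) t) has_real_derivative
      (\<Sum>i\<le>n. (p * lag (\<lambda>i. f i t) i + g i) * e (n - i) t + - (p * lag (\<lambda>i. e i t) (n - i)) * f i t)) (at t)"
    by (intro DERIV_sum DERIV_mult f e)
  also have "(\<Sum>i\<le>n. (p * lag (\<lambda>i. f i t) i + g i) * e (n - i) t + - (p * lag (\<lambda>i. e i t) (n - i)) * f i t)
      = p * ((\<Sum>i\<le>n. lag (\<lambda>i. f i t) i * e (n - i) t) - (\<Sum>i\<le>n. f i t * lag (\<lambda>i. e i t) (n - i)))
        + (\<Sum>i\<le>n. g i * e (n - i) t)"
    by (simp add: algebra_simps sum.distrib sum_subtractf sum_distrib_left)
  also have "\<dots> = (\<Sum>i\<le>n. g i * e (n - i) t)"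
    by (simp add: sum_lag_times[where g = "\<lambda>i. e i t"])
  finally show ?thesis .
qed

definition divided_power :: "nat \<Rightarrow> real \<Rightarrow> real" where
  "divided_power k x = x ^ k / fact k"

lemma divided_power_0 [simp]: "divided_power 0 x = 1"
  by (simp add: divided_power_def)

lemma divided_power_at_0 [simp]: "divided_power k 0 = of_bool (k = 0)"
  by (simp add: divided_power_def)

lemma divided_power_nonneg: "0 \<le> x \<Longrightarrow> 0 \<le> divided_power k x"
  by (simp add: divided_power_def)

lemma divided_power_mult:
  "divided_power k x * divided_power l x = real ((k + l) choose k) * divided_power (k + l) x"
  by (simp add: divided_power_def power_add binomial_fact)

lemma has_real_derivative_divided_power:
  assumes "(f has_real_derivative D) (at x)"
  shows "((\<lambda>x. divided_power k (f x)) has_real_derivative D * lag (\<lambda>k. divided_power k (f x)) k) (at x)"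
proof (cases k)
  case (Suc k')
  have "((\<lambda>x. f x ^ Suc k' / fact (Suc k')) has_real_derivative
      real (Suc k') * (D * f x ^ k') / fact (Suc k')) (at x)"
    using DERIV_cdivide[OF DERIV_power[OF assms, of "Suc k'"], of "fact (Suc k')"] by simp
  then show ?thesis
    using Suc by (simp add: divided_power_def divide_simps del: power_Suc of_nat_Suc)
qed simp

lemma continuous_on_divided_power [continuous_intros]:
  "continuous_on S f \<Longrightarrow> continuous_on S (\<lambda>x. divided_power k (f x))"
  unfolding divided_power_def by (intro continuous_intros) auto

section \<open>Alternating series and power series at the boundary\<close>

lemma summable_alternating_bounded_variation:
  fixes e :: "nat \<Rightarrow> real"
  assumes "e \<longlonglongrightarrow> 0" and "summable (\<lambda>n. \<bar>e n - e (Suc n)\<bar>)"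
  shows "summable (\<lambda>n. (-1) ^ n * e n)"
proof -
  have doubled: "(\<Sum>n<N. (-1) ^ n * (e n - e (Suc n)))
      = 2 * (\<Sum>n<N. (-1) ^ n * e n) - e 0 + (-1) ^ N * e N" for N
    by (induction N) (simp_all add: algebra_simps)
  have "summable (\<lambda>n. (-1) ^ n * (e n - e (Suc n)))"
    by (rule summable_comparison_test'[OF assms(2), of 0]) (simp add: abs_mult)
  moreover have "(\<lambda>N. (-1) ^ N * e N) \<longlonglongrightarrow> 0"
    using tendsto_rabs_zero[OF assms(1)]
    by (intro tendsto_rabs_zero_cancel[of "\<lambda>N. (-1) ^ N * e N"]) (simp add: abs_mult)
  ultimately have "(\<lambda>N. ((\<Sum>n<N. (-1) ^ n * (e n - e (Suc n))) + e 0 - (-1) ^ N * e N) / 2)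
      \<longlonglongrightarrow> ((\<Sum>n. (-1) ^ n * (e n - e (Suc n))) + e 0 - 0) / 2"
    by (intro tendsto_divide tendsto_diff tendsto_add tendsto_const summable_LIMSEQ) auto
  then show ?thesis
    unfolding doubled summable_def sums_def by auto
qed

lemma summable_alternating_partial_sums:
  fixes b w :: "nat \<Rightarrow> real"
  assumes b: "\<And>n. 0 \<le> b n" and w: "\<And>n. 0 \<le> w n" and w_dec: "\<And>n. w (Suc n) \<le> w n"
    and "summable (\<lambda>n. b n * w n)" and lim: "(\<lambda>n. w n * (\<Sum>j\<le>n. b j)) \<longlonglongrightarrow> 0"
  shows "summable (\<lambda>n. (-1) ^ n * (w n * (\<Sum>j\<le>n. b j)))"
proof (rule summable_alternating_bounded_variation[OF lim])
  define e p d where "e n = w n * (\<Sum>j\<le>n. b j)"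
    and "p n = b (Suc n) * w (Suc n)" and "d n = (w n - w (Suc n)) * (\<Sum>j\<le>n. b j)" for n
  have diff: "e n - e (Suc n) = d n - p n" for n
    by (simp add: e_def p_def d_def algebra_simps)
  have p: "summable p"
    using assms(4) unfolding p_def by (simp add: summable_Suc_iff[of "\<lambda>n. b n * w n"])
  have "summable (\<lambda>n. e n - e (Suc n))"
    using lim unfolding e_def by (rule telescope_summable')
  from summable_add[OF this p] have d: "summable d"
    by (simp add: diff)
  have "\<bar>e n - e (Suc n)\<bar> \<le> d n + p n" for n
  proof -
    have "0 \<le> d n" "0 \<le> p n"
      using b w w_dec by (auto simp: d_def p_def intro!: mult_nonneg_nonneg sum_nonneg)
    then show ?thesis by (simp add: diff abs_le_iff)
  qed
  then show "summable (\<lambda>n. \<bar>w n * (\<Sum>j\<le>n. b j) - w (Suc n) * (\<Sum>j\<le>Suc n. b j)\<bar>)"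
    unfolding e_def [symmetric] by (intro summable_comparison_test'[OF summable_add[OF d p], of 0]) simp
qed

text \<open>With \<open>a N = \<Sum>n\<le>N. (-1) ^ (N - n) * S n * y n\<close>, where \<open>S\<close> are the partial sums of \<open>b\<close>, the induction
  maintains \<open>S N * y N - P \<le> a N \<le> P\<close> for \<open>P = \<Sum>j\<le>N. b j * y j\<close>.\<close>
lemma abs_alternating_partial_sums_le:
  fixes b y :: "nat \<Rightarrow> real"
  assumes b: "\<And>j. 0 \<le> b j" and y: "\<And>n. 0 \<le> y n" and dec: "\<And>n. y (Suc n) \<le> y n"
  shows "\<bar>\<Sum>n<N. (-1) ^ n * ((\<Sum>j\<le>n. b j) * y n)\<bar> \<le> (\<Sum>j<N. b j * y j)"
proof (cases N)
  case (Suc N')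
  define S a P where "S n = (\<Sum>j\<le>n. b j)" and "a n = (-1) ^ n * (\<Sum>k\<le>n. (-1) ^ k * (S k * y k))"
    and "P n = (\<Sum>j\<le>n. b j * y j)" for n
  have a_Suc: "a (Suc n) = S (Suc n) * y (Suc n) - a n" for n
    by (simp add: a_def algebra_simps flip: power_add)
  have "S n * y n - P n \<le> a n \<and> a n \<le> P n" for n
  proof (induction n)
    case 0
    show ?case using b y by (simp add: a_def S_def P_def)
  next
    case (Suc n)
    have "0 \<le> S n" by (simp add: S_def b sum_nonneg)
    then have "S n * y (Suc n) \<le> S n * y n" by (rule mult_left_mono[OF dec])
    moreover have "S (Suc n) * y (Suc n) = S n * y (Suc n) + b (Suc n) * y (Suc n)"
      by (simp add: S_def distrib_right)
    moreover have "0 \<le> b (Suc n) * y (Suc n)" using b y by simp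
    moreover have "P (Suc n) = P n + b (Suc n) * y (Suc n)" by (simp add: P_def)
    ultimately show ?case using Suc.IH unfolding a_Suc by linarith
  qed
  moreover have "0 \<le> S n * y n" for n
    using b y by (simp add: S_def sum_nonneg)
  ultimately have "\<bar>a N'\<bar> \<le> P N'" by (smt (verit))
  then show ?thesis
    by (simp add: Suc a_def P_def S_def abs_mult lessThan_Suc_atMost)
qed simp

lemma Abel_inequality:
  fixes b y :: "nat \<Rightarrow> real"
  assumes bound: "\<And>j. j \<le> n \<Longrightarrow> \<bar>\<Sum>k<j. b k\<bar> \<le> e"
    and dec: "\<And>k. y (Suc k) \<le> y k" and nonneg: "\<And>k. 0 \<le> y k"
  shows "\<bar>\<Sum>k<n. b k * y k\<bar> \<le> e * y 0"
proof -
  have parts: "(\<Sum>k<n. b k * y k) = (\<Sum>k<n. (\<Sum>i<Suc k. b i) * (y k - y (Suc k))) + (\<Sum>i<n. b i) * y n"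
    for n
    by (induction n) (simp_all add: algebra_simps)
  have "\<bar>\<Sum>k<n. b k * y k\<bar> \<le> (\<Sum>k<n. \<bar>\<Sum>i<Suc k. b i\<bar> * (y k - y (Suc k))) + \<bar>\<Sum>i<n. b i\<bar> * y n"
    unfolding parts
    by (intro order.trans[OF abs_triangle_ineq] add_mono order.trans[OF sum_abs])
       (simp_all add: abs_mult dec nonneg del: sum.lessThan_Suc)
  also have "\<dots> \<le> (\<Sum>k<n. e * (y k - y (Suc k))) + e * y n"
    by (intro add_mono sum_mono mult_right_mono bound) (auto simp: dec nonneg)
  also have "\<dots> = e * y 0"
    by (simp only: sum_distrib_left [symmetric] sum_lessThan_telescope') (simp add: algebra_simps)
  finally show ?thesis .
qed

lemma uniformly_convergent_power_series_Icc:
  fixes a :: "nat \<Rightarrow> real"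
  assumes "summable a"
  shows "uniformly_convergent_on {0..1} (\<lambda>n x. \<Sum>k<n. a k * x ^ k)"
proof (rule Cauchy_uniformly_convergent, unfold uniformly_Cauchy_on_def, intro allI impI)
  fix \<epsilon> :: real assume "\<epsilon> > 0"
  then obtain N where N: "\<And>m n. m \<ge> N \<Longrightarrow> norm (\<Sum>k=m..<n. a k) < \<epsilon> / 2"
    using assms[unfolded summable_Cauchy] by (meson half_gt_zero)
  have tail: "\<bar>(\<Sum>k<m + n. a k * x ^ k) - (\<Sum>k<m. a k * x ^ k)\<bar> < \<epsilon>"
    if x: "x \<in> {0..1}" and m: "N \<le> m" for x m n
  proof -
    have shift: "(\<Sum>k<m + j. f k) - (\<Sum>k<m. f k) = (\<Sum>k<j. f (m + k))" for f :: "nat \<Rightarrow> real" and j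
      by (induction j) simp_all
    have "\<bar>(\<Sum>k<m + n. a k * x ^ k) - (\<Sum>k<m. a k * x ^ k)\<bar> = \<bar>\<Sum>k<n. a (m + k) * x ^ (m + k)\<bar>"
      by (simp only: shift)
    also have "\<dots> \<le> \<epsilon> / 2 * x ^ (m + 0)"
    proof (rule Abel_inequality)
      show "\<bar>\<Sum>k<j. a (m + k)\<bar> \<le> \<epsilon> / 2" for j
        using N[OF m, of "m + j"] sum_diff_nat_ivl[of 0 m "m + j" a]
        by (simp add: atLeast0LessThan flip: shift)
    qed (use x in \<open>auto simp: mult_left_le_one_le\<close>)
    also have "\<dots> \<le> \<epsilon> / 2 * 1"
      using x \<open>\<epsilon> > 0\<close> by (intro mult_left_mono) (auto simp: power_le_one)
    finally show ?thesis using \<open>\<epsilon> > 0\<close> by simp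
  qed
  show "\<exists>N. \<forall>x\<in>{0..1}. \<forall>m\<ge>N. \<forall>n\<ge>N. dist (\<Sum>k<m. a k * x ^ k) (\<Sum>k<n. a k * x ^ k) < \<epsilon>"
  proof (intro exI[of _ N] ballI allI impI)
    fix x :: real and m n assume "x \<in> {0..1}" "N \<le> m" "N \<le> n"
    then show "dist (\<Sum>k<m. a k * x ^ k) (\<Sum>k<n. a k * x ^ k) < \<epsilon>"
      using tail[of x m "n - m"] tail[of x n "m - n"]
      by (cases "m \<le> n") (auto simp: dist_real_def abs_minus_commute)
  qed
qed

theorem Abel_limit_theorem:
  fixes a :: "nat \<Rightarrow> real"
  assumes "summable a"
  shows "continuous_on {0..1} (\<lambda>x. \<Sum>n. a n * x ^ n)"
proof -
  have "uniform_limit {0..1} (\<lambda>n x. \<Sum>k<n. a k * x ^ k) (\<lambda>x. \<Sum>n. a n * x ^ n) sequentially"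
    using uniformly_convergent_power_series_Icc[OF assms]
    by (simp add: uniformly_convergent_uniform_limit_iff suminf_eq_lim)
  then show ?thesis
    by (rule uniform_limit_theorem[rotated]) (auto intro!: always_eventually continuous_intros)
qed

lemma power_series_derivative_sums:
  fixes c :: "nat \<Rightarrow> real"
  assumes summable: "\<And>x. \<bar>x\<bar> < R \<Longrightarrow> summable (\<lambda>n. c n * x ^ n)" and x: "\<bar>x\<bar> < R"
  obtains D where "((\<lambda>x. \<Sum>n. c n * x ^ n) has_real_derivative D) (at x)"
    and "(\<lambda>n. real n * c n * x ^ n) sums (x * D)"
proof
  show "((\<lambda>x. \<Sum>n. c n * x ^ n) has_real_derivative (\<Sum>n. diffs c n * x ^ n)) (at x)"
    by (rule termdiffs_strong'[of R]) (use assms in auto)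
  have "summable (\<lambda>n. diffs c n * x ^ n)"
    by (rule termdiff_converges[of x R]) (use assms in auto)
  from sums_mult[OF diffs_equiv[OF this], of x]
  have "(\<lambda>n. x * (real n * c n * x ^ (n - Suc 0))) sums (x * (\<Sum>n. diffs c n * x ^ n))" .
  moreover have "x * (real n * c n * x ^ (n - Suc 0)) = real n * c n * x ^ n" for n
    by (cases n) auto
  ultimately show "(\<lambda>n. real n * c n * x ^ n) sums (x * (\<Sum>n. diffs c n * x ^ n))"
    by simp
qed

section \<open>Alternating series for W\<close>

text \<open>The exponents are listed from the outermost summation inwards. In terms of \<open>m\<^sub>i = n\<^sub>i - i\<close> the summation
  range is \<open>0 \<le> m\<^sub>1 \<le> \<dots> \<le> m\<^sub>r\<close> and the bases are \<open>2 * n\<^sub>i - i = 2 * m\<^sub>i + i\<close>; the argument \<open>n\<close> is \<open>m\<^sub>r\<close>.\<close>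
primrec Tbar_coeff :: "nat list \<Rightarrow> nat \<Rightarrow> real" where
  "Tbar_coeff [] n = of_bool (n = 0)"
| "Tbar_coeff (k # ks) n = 2 / real (2 * n + length ks + 1) ^ k * (\<Sum>j\<le>n. Tbar_coeff ks j)"

lemma Tbar_coeff_nonneg: "0 \<le> Tbar_coeff ks n"
  by (induction ks arbitrary: n) (auto intro!: sum_nonneg divide_nonneg_nonneg mult_nonneg_nonneg)

lemma inverse_power_le_inverse:
  assumes "0 < k"
  shows "2 / real (2 * n + l + 1) ^ k \<le> 2 / real (Suc n)"
proof -
  have "real (Suc n) \<le> real (2 * n + l + 1) ^ 1" by simp
  also have "\<dots> \<le> real (2 * n + l + 1) ^ k"
    using assms by (intro power_increasing) auto
  finally show ?thesis by (intro divide_left_mono) auto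
qed

lemma inverse_power_bigo:
  assumes "0 < k"
  shows "(\<lambda>n. 2 / real (2 * n + l + 1) ^ k) \<in> O(\<lambda>n. 1 / real n)"
proof (rule landau_o.big_trans)
  show "(\<lambda>n. 2 / real (2 * n + l + 1) ^ k) \<in> O(\<lambda>n. 2 / real (Suc n))"
    using inverse_power_le_inverse[OF assms, of _ l] by (intro bigoI[of _ 1]) simp
  show "(\<lambda>n. 2 / real (Suc n)) \<in> O(\<lambda>n. 1 / real n)" by real_asymp
qed

lemma partial_sums_Tbar_coeff_le_harm:
  assumes "\<forall>k\<in>set ks. 0 < k"
  shows "(\<Sum>j\<le>n. Tbar_coeff ks j) \<le> (2 * harm (n + 1)) ^ length ks"
  using assms
proof (induction ks arbitrary: n)
  case (Cons k ks)
  have "Tbar_coeff (k # ks) j \<le> 2 / real (Suc j) * (2 * harm (n + 1)) ^ length ks" if "j \<le> n" for j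
  proof -
    have "(\<Sum>i\<le>j. Tbar_coeff ks i) \<le> (\<Sum>i\<le>n. Tbar_coeff ks i)"
      using that by (intro sum_mono2) (auto simp: Tbar_coeff_nonneg)
    also have "\<dots> \<le> (2 * harm (n + 1)) ^ length ks"
      using Cons by simp
    finally show ?thesis
      using inverse_power_le_inverse[of k j "length ks"] Cons.prems unfolding Tbar_coeff.simps
      by (intro mult_mono) (auto intro!: sum_nonneg Tbar_coeff_nonneg)
  qed
  then have "(\<Sum>j\<le>n. Tbar_coeff (k # ks) j) \<le> (\<Sum>j\<le>n. 2 / real (Suc j) * (2 * harm (n + 1)) ^ length ks)"
    by (intro sum_mono) auto
  also have "\<dots> = (2 * harm (n + 1)) ^ length (k # ks)"
    by (simp add: sum_distrib_right [symmetric] harm_altdef sum_distrib_left lessThan_Suc_atMost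
        divide_inverse)
  finally show ?case .
qed simp

lemma harm_Suc_le: "harm (Suc n) \<le> 1 + ln (real (Suc n))"
  using decseqD[OF decseq_harm_diff_ln, of 0 n] by (simp add: harm_expand)

lemma partial_sums_Tbar_coeff_smallo:
  assumes "\<forall>k\<in>set ks. 0 < k"
  shows "(\<lambda>n. \<Sum>j\<le>n. Tbar_coeff ks j) \<in> o(\<lambda>n. real n powr (1/2))"
proof (rule landau_o.big_small_trans)
  have "(\<Sum>j\<le>n. Tbar_coeff ks j) \<le> (2 + 2 * ln (real (Suc n))) ^ length ks" for n
  proof -
    have "(\<Sum>j\<le>n. Tbar_coeff ks j) \<le> (2 * harm (Suc n)) ^ length ks"
      using partial_sums_Tbar_coeff_le_harm[OF assms] by simp
    also have "\<dots> \<le> (2 + 2 * ln (real (Suc n))) ^ length ks"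
      using harm_Suc_le[of n] harm_nonneg[of "Suc n", where 'a = real] by (intro power_mono) auto
    finally show ?thesis .
  qed
  then show "(\<lambda>n. \<Sum>j\<le>n. Tbar_coeff ks j) \<in> O(\<lambda>n. (2 + 2 * ln (real (Suc n))) ^ length ks)"
    by (intro bigoI[of _ 1]) (simp add: Tbar_coeff_nonneg sum_nonneg abs_of_nonneg)
  show "(\<lambda>n. (2 + 2 * ln (real (Suc n))) ^ length ks) \<in> o(\<lambda>n. real n powr (1/2))"
    by real_asymp
qed

lemma Tbar_coeff_bigo:
  assumes "\<forall>k\<in>set ks. 0 < k"
  shows "Tbar_coeff ks \<in> O(\<lambda>n. real n powr (-1/2))"
proof (cases ks)
  case Nil
  then show ?thesis
    using eventually_gt_at_top[of 0] by (intro bigoI[of _ 0]) (auto elim: eventually_mono)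
next
  case (Cons k ls)
  have "(\<lambda>n. \<Sum>j\<le>n. Tbar_coeff ls j) \<in> O(\<lambda>n. real n powr (1/2))"
    using assms Cons by (intro landau_o.small_imp_big partial_sums_Tbar_coeff_smallo) simp
  then have "Tbar_coeff ks \<in> O(\<lambda>n. 1 / real n * real n powr (1/2))"
    unfolding Cons Tbar_coeff.simps [abs_def] using assms Cons
    by (intro landau_o.big.mult inverse_power_bigo) simp_all
  also have "(\<lambda>n. 1 / real n * real n powr (1/2)) \<in> O(\<lambda>n. real n powr (-1/2))"
    by real_asymp
  finally show ?thesis .
qed

lemma summable_alternating_Tbar_coeff:
  assumes "\<forall>k\<in>set ks. 0 < k"
  shows "summable (\<lambda>n. (-1) ^ n * Tbar_coeff ks n)"
proof (cases ks)
  case Nil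
  then show ?thesis by (intro summable_finite[of "{0}"]) auto
next
  case (Cons k ls)
  define w where "w n = 2 / real (2 * n + length ls + 1) ^ k" for n
  have ls: "\<forall>k\<in>set ls. 0 < k" and w_bigo: "w \<in> O(\<lambda>n. 1 / real n)"
    using assms Cons inverse_power_bigo[of k "length ls"] by (simp_all add: w_def [abs_def])
  have "summable (\<lambda>n. (-1) ^ n * (w n * (\<Sum>j\<le>n. Tbar_coeff ls j)))"
  proof (rule summable_alternating_partial_sums)
    show "w (Suc n) \<le> w n" for n
      unfolding w_def by (intro divide_left_mono power_mono) auto
    have "(\<lambda>n. Tbar_coeff ls n * w n) \<in> O(\<lambda>n. real n powr (-1/2) * (1 / real n))"
      by (intro landau_o.big.mult Tbar_coeff_bigo ls w_bigo)
    also have "(\<lambda>n. real n powr (-1/2) * (1 / real n)) \<in> O(\<lambda>n. real n powr (-3/2))"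
      by real_asymp
    finally show "summable (\<lambda>n. Tbar_coeff ls n * w n)"
      by (rule summable_comparison_test_bigo[rotated]) (simp add: summable_real_powr_iff)
    have "(\<lambda>n. w n * (\<Sum>j\<le>n. Tbar_coeff ls j)) \<in> o(\<lambda>n. 1 / real n * real n powr (1/2))"
      by (intro landau_o.big_small_mult w_bigo partial_sums_Tbar_coeff_smallo ls)
    also have "(\<lambda>n. 1 / real n * real n powr (1/2)) \<in> O(\<lambda>_. 1)"
      by real_asymp
    finally show "(\<lambda>n. w n * (\<Sum>j\<le>n. Tbar_coeff ls j)) \<longlonglongrightarrow> 0"
      using smalloD_tendsto by fastforce
  qed (auto simp: w_def Tbar_coeff_nonneg)
  then show ?thesis by (simp add: Cons w_def)
qed

definition strict_lists :: "nat \<Rightarrow> nat \<Rightarrow> nat list set" where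
  "strict_lists r N = {ns. length ns = r \<and> sorted_wrt (<) ns \<and> set ns \<subseteq> {1..N}}"

lemma finite_strict_lists: "finite (strict_lists r N)"
  by (rule finite_subset[OF _ finite_lists_length_eq[of "{1..N}" r]]) (auto simp: strict_lists_def)

lemma strict_lists_Suc: "strict_lists (Suc r) N = (\<Union>m\<in>{1..N}. (\<lambda>ns. ns @ [m]) ` strict_lists r (m - 1))"
proof (intro set_eqI)
  fix xs
  have "ns @ [m] \<in> strict_lists (Suc r) N \<longleftrightarrow> m \<in> {1..N} \<and> ns \<in> strict_lists r (m - 1)" for ns m
    by (fastforce simp: strict_lists_def sorted_wrt_append)
  then show "xs \<in> strict_lists (Suc r) N \<longleftrightarrow> xs \<in> (\<Union>m\<in>{1..N}. (\<lambda>ns. ns @ [m]) ` strict_lists r (m - 1))"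
    by (cases xs rule: rev_cases) (auto simp: strict_lists_def[of "Suc r"])
qed

definition Tbar_sum :: "(nat \<Rightarrow> real) \<Rightarrow> nat list \<Rightarrow> nat \<Rightarrow> real" where
  "Tbar_sum g ks N = (\<Sum>ns\<in>strict_lists (length ks) N.
     2 ^ length ks * g (last ns) / (\<Prod>i<length ks. (2 * real (ns ! i) - real (i + 1)) ^ (ks ! i)))"

lemma Tbar_partial_eq_Tbar_sum: "Tbar_partial ks N = Tbar_sum (\<lambda>n. (-1) ^ n) ks N"
  by (simp add: Tbar_partial_def Tbar_sum_def strict_lists_def)

lemma Tbar_sum_snoc:
  "Tbar_sum g (ks @ [k]) N
     = (\<Sum>m=1..N. g m * (2 / (2 * real m - real (length ks + 1)) ^ k) * Tbar_sum (\<lambda>_. 1) ks (m - 1))"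
proof -
  let ?base = "\<lambda>i n. 2 * real n - real (i + 1)"
  let ?term = "\<lambda>ns. 2 ^ Suc (length ks) * g (last ns)
      / (\<Prod>i<Suc (length ks). ?base i (ns ! i) ^ ((ks @ [k]) ! i))"
  have "Tbar_sum g (ks @ [k]) N = (\<Sum>m=1..N. \<Sum>ns\<in>strict_lists (length ks) (m - 1). ?term (ns @ [m]))"
    unfolding Tbar_sum_def length_append_singleton strict_lists_Suc
    by (rule sum_UN_image) (auto simp: finite_strict_lists inj_on_def)
  also have "?term (ns @ [m]) = g m * (2 / ?base (length ks) m ^ k)
      * (2 ^ length ks * 1 / (\<Prod>i<length ks. ?base i (ns ! i) ^ (ks ! i)))"
    if "ns \<in> strict_lists (length ks) (m - 1)" for m ns
  proof -
    have len: "length ns = length ks" using that by (simp add: strict_lists_def)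
    then have "(\<Prod>i<length ks. ?base i ((ns @ [m]) ! i) ^ ((ks @ [k]) ! i))
        = (\<Prod>i<length ks. ?base i (ns ! i) ^ (ks ! i))"
      by (intro prod.cong) (auto simp: nth_append)
    with len show ?thesis
      by (simp only: prod.lessThan_Suc nth_append last_snoc) (simp add: ac_simps)
  qed
  then have "(\<Sum>m=1..N. \<Sum>ns\<in>strict_lists (length ks) (m - 1). ?term (ns @ [m]))
      = (\<Sum>m=1..N. g m * (2 / ?base (length ks) m ^ k) * Tbar_sum (\<lambda>_. 1) ks (m - 1))"
    unfolding Tbar_sum_def sum_distrib_left by (intro sum.cong refl)
  finally show ?thesis .
qed

lemma sum_atLeastAtMost_drop_zeros:
  fixes f :: "nat \<Rightarrow> real"
  assumes "\<And>m. 0 < m \<Longrightarrow> m \<le> l \<Longrightarrow> f m = 0"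
  shows "(\<Sum>m=1..N. f m) = (\<Sum>n<N - l. f (n + l + 1))"
proof (induction N)
  case (Suc N)
  then show ?case
    using assms by (cases "N < l") (auto simp: Suc_diff_le)
qed simp

lemma Tbar_sum_snoc_eq_sum_Tbar_coeff:
  assumes "\<And>N. Tbar_sum (\<lambda>_. 1) ks N = (\<Sum>j<Suc N - length ks. Tbar_coeff (rev ks) j)"
  shows "Tbar_sum g (ks @ [k]) N
      = (\<Sum>n<N - length ks. g (n + length ks + 1) * Tbar_coeff (k # rev ks) n)"
  unfolding Tbar_sum_snoc assms
  by (subst sum_atLeastAtMost_drop_zeros[where l = "length ks"])
     (auto simp: lessThan_Suc_atMost Suc_diff_le intro!: sum.cong)

lemma Tbar_sum_1_eq_sum_Tbar_coeff:
  "Tbar_sum (\<lambda>_. 1) ks N = (\<Sum>j<Suc N - length ks. Tbar_coeff (rev ks) j)"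
proof (induction ks arbitrary: N rule: rev_induct)
  case Nil
  have "strict_lists 0 N = {[]}" by (auto simp: strict_lists_def)
  then show ?case by (simp add: Tbar_sum_def lessThan_Suc_atMost)
next
  case (snoc k ks)
  show ?case by (simp add: Tbar_sum_snoc_eq_sum_Tbar_coeff[OF snoc.IH])
qed

lemma Tbar_eq_suminf:
  assumes "ks \<noteq> []" "\<forall>k\<in>set ks. 0 < k"
  shows "Tbar ks = (-1) ^ length ks * (\<Sum>n. (-1) ^ n * Tbar_coeff (rev ks) n)"
proof -
  obtain ls k where ks: "ks = ls @ [k]" using assms(1) by (metis rev_exhaust)
  have "Tbar_partial ks (N + length ls) = (-1) ^ length ks * (\<Sum>n<N. (-1) ^ n * Tbar_coeff (rev ks) n)"
    for N
    by (simp add: Tbar_partial_eq_Tbar_sum ks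
        Tbar_sum_snoc_eq_sum_Tbar_coeff[OF Tbar_sum_1_eq_sum_Tbar_coeff]
        sum_distrib_left power_add mult_ac del: Tbar_coeff.simps)
  moreover have "(\<lambda>N. (-1) ^ length ks * (\<Sum>n<N. (-1) ^ n * Tbar_coeff (rev ks) n))
      \<longlonglongrightarrow> (-1) ^ length ks * (\<Sum>n. (-1) ^ n * Tbar_coeff (rev ks) n)"
    by (intro tendsto_mult tendsto_const summable_LIMSEQ summable_alternating_Tbar_coeff)
       (use assms in auto)
  ultimately have "(\<lambda>N. Tbar_partial ks (N + length ls))
      \<longlonglongrightarrow> (-1) ^ length ks * (\<Sum>n. (-1) ^ n * Tbar_coeff (rev ks) n)"
    by simp
  then show ?thesis
    unfolding Tbar_def by (intro limI) (rule LIMSEQ_offset)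
qed

definition W_coeff :: "nat \<Rightarrow> nat \<Rightarrow> nat \<Rightarrow> real" where
  "W_coeff r q n = (\<Sum>ks\<in>Iset (r + q) r. Tbar_coeff ks n)"

lemma finite_Iset: "finite (Iset k r)"
proof (rule finite_subset)
  show "Iset k r \<subseteq> {ks. set ks \<subseteq> {..k} \<and> length ks = r}"
    by (auto simp: Iset_def member_le_sum_list)
qed (rule finite_lists_length_eq, simp)

lemma Iset_Suc: "Iset (Suc r + q) (Suc r) = (\<Union>i\<in>{..q}. (#) (Suc i) ` Iset (r + (q - i)) r)"
proof (intro set_eqI)
  fix xs
  have length_le: "length ks \<le> sum_list ks" if "\<forall>x\<in>set ks. 0 < x" for ks :: "nat list"
    using that by (induction ks) auto
  have Cons_iff: "k # ks \<in> Iset (Suc r + q) (Suc r) \<longleftrightarrow> (\<exists>i\<le>q. k = Suc i \<and> ks \<in> Iset (r + (q - i)) r)"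
    for k ks
    using length_le[of ks] by (cases k) (auto simp: Iset_def)
  show "xs \<in> Iset (Suc r + q) (Suc r) \<longleftrightarrow> xs \<in> (\<Union>i\<in>{..q}. (#) (Suc i) ` Iset (r + (q - i)) r)"
  proof (cases xs)
    case Nil
    then show ?thesis by (simp add: Iset_def[of _ "Suc r"] image_iff)
  next
    case (Cons k ks)
    show ?thesis unfolding Cons Cons_iff by (auto simp: image_iff)
  qed
qed

lemma W_coeff_0: "W_coeff 0 q n = of_bool (q = 0 \<and> n = 0)"
proof -
  have "Iset q 0 = (if q = 0 then {[]} else {})"
    by (auto simp: Iset_def)
  then show ?thesis by (simp add: W_coeff_def)
qed

lemma W_coeff_Suc_eq_sum:
  "W_coeff (Suc r) q n = (\<Sum>i\<le>q. 2 / real (2 * n + r + 1) ^ Suc i * (\<Sum>j\<le>n. W_coeff r (q - i) j))"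
proof -
  have "W_coeff (Suc r) q n = (\<Sum>i\<le>q. \<Sum>ks\<in>Iset (r + (q - i)) r. Tbar_coeff (Suc i # ks) n)"
    unfolding W_coeff_def Iset_Suc by (rule sum_UN_image) (auto simp: finite_Iset inj_on_def)
  also have "\<dots> = (\<Sum>i\<le>q. \<Sum>ks\<in>Iset (r + (q - i)) r.
      2 / real (2 * n + r + 1) ^ Suc i * (\<Sum>j\<le>n. Tbar_coeff ks j))"
    by (intro sum.cong refl) (simp add: Iset_def)
  also have "\<dots> = (\<Sum>i\<le>q. 2 / real (2 * n + r + 1) ^ Suc i * (\<Sum>j\<le>n. W_coeff r (q - i) j))"
    unfolding W_coeff_def sum_distrib_left [symmetric]
    by (intro sum.cong refl arg_cong2[of _ _ _ _ "(*)"] sum.swap)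
  finally show ?thesis .
qed

lemma W_coeff_Suc:
  "real (2 * n + r + 1) * W_coeff (Suc r) q n
      = lag (\<lambda>q. W_coeff (Suc r) q n) q + 2 * (\<Sum>j\<le>n. W_coeff r q j)"
proof (cases q)
  case 0
  then show ?thesis by (simp add: W_coeff_Suc_eq_sum)
next
  case (Suc q')
  let ?c = "real (2 * n + r + 1)"
  have "?c * W_coeff (Suc r) q n = ?c * (2 / ?c ^ Suc 0 * (\<Sum>j\<le>n. W_coeff r q j))
      + ?c * (\<Sum>i\<le>q'. 2 / ?c ^ Suc (Suc i) * (\<Sum>j\<le>n. W_coeff r (q' - i) j))"
    unfolding Suc W_coeff_Suc_eq_sum by (subst sum.atMost_Suc_shift) (simp add: distrib_left)
  also have "?c * (\<Sum>i\<le>q'. 2 / ?c ^ Suc (Suc i) * (\<Sum>j\<le>n. W_coeff r (q' - i) j)) = W_coeff (Suc r) q' n"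
    unfolding W_coeff_Suc_eq_sum sum_distrib_left by (intro sum.cong refl) simp
  finally show ?thesis using Suc by simp
qed

lemma W_coeff_nonneg: "0 \<le> W_coeff r q n"
  unfolding W_coeff_def by (intro sum_nonneg Tbar_coeff_nonneg)

lemma summable_alternating_W_coeff: "summable (\<lambda>n. (-1) ^ n * W_coeff r q n)"
  unfolding W_coeff_def sum_distrib_left
  by (intro summable_sum summable_alternating_Tbar_coeff) (simp add: Iset_def)

lemma W_eq_suminf:
  assumes "0 < r"
  shows "W (r + q) r = (-1) ^ r * (\<Sum>n. (-1) ^ n * W_coeff r q n)"
proof -
  have "W (r + q) r = (\<Sum>ks\<in>Iset (r + q) r. (-1) ^ r * (\<Sum>n. (-1) ^ n * Tbar_coeff (rev ks) n))"
    unfolding W_def using assms by (intro sum.cong refl) (subst Tbar_eq_suminf, auto simp: Iset_def)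
  also have "\<dots> = (\<Sum>ks\<in>Iset (r + q) r. (-1) ^ r * (\<Sum>n. (-1) ^ n * Tbar_coeff ks n))"
    by (rule sum.reindex_bij_witness[of _ rev rev]) (auto simp: Iset_def)
  also have "\<dots> = (-1) ^ r * (\<Sum>n. \<Sum>ks\<in>Iset (r + q) r. (-1) ^ n * Tbar_coeff ks n)"
    unfolding sum_distrib_left[of "(-1) ^ r", symmetric]
    by (subst suminf_sum) (auto intro!: summable_alternating_Tbar_coeff simp: Iset_def)
  finally show ?thesis by (simp add: W_coeff_def sum_distrib_left)
qed

section \<open>Generating functions\<close>

definition W_series :: "nat \<Rightarrow> nat \<Rightarrow> real \<Rightarrow> real" where
  "W_series r q x = (\<Sum>n. W_coeff r q n * x ^ n)"

lemma summable_W_coeff_power: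
  assumes "\<bar>x\<bar> < 1"
  shows "summable (\<lambda>n. W_coeff r q n * x ^ n)"
    and "summable (\<lambda>n. norm (W_coeff r q n * x ^ n))"
proof -
  have "summable (\<lambda>n. W_coeff r q n * (-1) ^ n)"
    using summable_alternating_W_coeff[of r q] by (simp add: mult.commute)
  then show "summable (\<lambda>n. W_coeff r q n * x ^ n)" "summable (\<lambda>n. norm (W_coeff r q n * x ^ n))"
    by (rule powser_inside powser_insidea; use assms in simp)+
qed

lemma W_series_0: "W_series 0 q x = of_bool (q = 0)"
proof -
  have "(\<lambda>n. W_coeff 0 q n * x ^ n) sums (\<Sum>n\<in>{0}. W_coeff 0 q n * x ^ n)"
    by (rule sums_finite) (auto simp: W_coeff_0)
  then show ?thesis
    unfolding W_series_def by (simp add: sums_iff W_coeff_0)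
qed

lemma sums_partial_sums_W_coeff_power:
  assumes "\<bar>x\<bar> < 1"
  shows "(\<lambda>n. (\<Sum>j\<le>n. W_coeff r q j) * x ^ n) sums (W_series r q x / (1 - x))"
proof -
  have "summable (\<lambda>n. norm (x ^ n))"
    unfolding norm_power by (rule summable_geometric) (use assms in simp)
  then have "(\<lambda>n. \<Sum>j\<le>n. W_coeff r q j * x ^ j * x ^ (n - j)) sums (W_series r q x * (\<Sum>n. x ^ n))"
    unfolding W_series_def by (intro Cauchy_product_sums summable_W_coeff_power assms)
  then show ?thesis
    using assms by (simp add: suminf_geometric sum_distrib_right mult.assoc flip: power_add)
qed

lemma W_series_ODE:
  assumes x: "\<bar>x\<bar> < 1"
  obtains D where "(W_series (Suc r) q has_real_derivative D) (at x)"
    "2 * (x * D) + real (Suc r) * W_series (Suc r) q x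
       = lag (\<lambda>q. W_series (Suc r) q x) q + 2 * (W_series r q x / (1 - x))"
proof -
  let ?c = "W_coeff (Suc r) q"
  obtain D where deriv: "(W_series (Suc r) q has_real_derivative D) (at x)"
    and D: "(\<lambda>n. real n * ?c n * x ^ n) sums (x * D)"
    using power_series_derivative_sums[OF summable_W_coeff_power(1) x, of "Suc r" q]
    unfolding W_series_def [abs_def] by auto
  have series: "(\<lambda>n. W_coeff r q n * x ^ n) sums W_series r q x" for r q
    unfolding W_series_def by (intro summable_sums summable_W_coeff_power x)
  have lag_series: "(\<lambda>n. lag (\<lambda>q. W_coeff (Suc r) q n) q * x ^ n) sums lag (\<lambda>q. W_series (Suc r) q x) q"
    using series by (cases q) auto
  have "(\<lambda>n. 2 * (real n * ?c n * x ^ n) + real (Suc r) * (?c n * x ^ n))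
      sums (2 * (x * D) + real (Suc r) * W_series (Suc r) q x)"
    by (intro sums_add sums_mult D series)
  moreover have "2 * (real n * ?c n * x ^ n) + real (Suc r) * (?c n * x ^ n)
      = lag (\<lambda>q. W_coeff (Suc r) q n) q * x ^ n + 2 * ((\<Sum>j\<le>n. W_coeff r q j) * x ^ n)" for n
  proof -
    have "2 * (real n * ?c n * x ^ n) + real (Suc r) * (?c n * x ^ n)
        = (real (2 * n + r + 1) * ?c n) * x ^ n"
      by (simp add: algebra_simps)
    then show ?thesis
      unfolding W_coeff_Suc by (simp add: algebra_simps)
  qed
  ultimately have "2 * (x * D) + real (Suc r) * W_series (Suc r) q x
      = lag (\<lambda>q. W_series (Suc r) q x) q + 2 * (W_series r q x / (1 - x))"
    using sums_add[OF lag_series sums_mult[OF sums_partial_sums_W_coeff_power[OF x, of r q], of 2]]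
    by (simp only: sums_unique2)
  with deriv show ?thesis by (rule that)
qed

lemma isCont_W_series:
  assumes "\<bar>x\<bar> < 1"
  shows "isCont (W_series r q) x"
proof (cases r)
  case 0
  then show ?thesis by (simp add: W_series_0 [abs_def])
next
  case (Suc r')
  then show ?thesis using W_series_ODE[OF assms, of r' q] DERIV_isCont by metis
qed

lemma continuous_on_W_series_uminus: "continuous_on {0..1} (\<lambda>x. W_series r q (- x))"
proof -
  have "W_series r q (- x) = (\<Sum>n. ((-1) ^ n * W_coeff r q n) * x ^ n)" for x
    unfolding W_series_def by (rule suminf_cong) (subst power_minus, simp)
  then show ?thesis
    using Abel_limit_theorem[OF summable_alternating_W_coeff[of r q]] by simp
qed

text \<open>For \<open>s = -1\<close> this is, up to the sign \<open>(-1) ^ r\<close>, the series for \<open>W (r + q) r\<close> with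
  \<open>t ^ (2 * n\<^sub>r - r)\<close> inserted; the case \<open>s = 1\<close> provides the dominating function in the exchange of sum and integral.\<close>
definition W_fun :: "real \<Rightarrow> nat \<Rightarrow> nat \<Rightarrow> real \<Rightarrow> real" where
  "W_fun s r q t = t ^ r * W_series r q (s * t\<^sup>2)"

lemma W_fun_0: "W_fun s 0 q t = of_bool (q = 0)"
  by (simp add: W_fun_def W_series_0)

lemma W_fun_Suc_at_0: "W_fun s (Suc r) q 0 = 0"
  by (simp add: W_fun_def)

lemma abs_times_square_less_1:
  fixes s t :: real
  assumes "\<bar>s\<bar> = 1" "0 \<le> t" "t < 1"
  shows "\<bar>s * t\<^sup>2\<bar> < 1"
  using assms by (simp add: abs_mult power_less_one_iff)

lemma has_real_derivative_W_fun:
  assumes s: "\<bar>s\<bar> = 1" and t: "0 < t" "t < 1"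
  shows "(W_fun s (Suc r) q has_real_derivative
     1 / t * lag (\<lambda>q. W_fun s (Suc r) q t) q + 2 / (1 - s * t\<^sup>2) * W_fun s r q t) (at t)"
proof -
  define x where "x = s * t\<^sup>2"
  have "\<bar>x\<bar> < 1"
    unfolding x_def using t by (intro abs_times_square_less_1 s) auto
  then obtain D where D: "(W_series (Suc r) q has_real_derivative D) (at x)"
    and ODE: "2 * (x * D) + real (Suc r) * W_series (Suc r) q x
       = lag (\<lambda>q. W_series (Suc r) q x) q + 2 * (W_series r q x / (1 - x))"
    by (rule W_series_ODE)
  have "((\<lambda>t. s * t\<^sup>2) has_real_derivative 2 * s * t) (at t)"
    by (auto intro!: derivative_eq_intros)
  from DERIV_mult[OF DERIV_pow[of "Suc r" t] DERIV_chain2[OF D[unfolded x_def] this]]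
  have "(W_fun s (Suc r) q has_real_derivative
      real (Suc r) * t ^ r * W_series (Suc r) q x + t ^ Suc r * (D * (2 * s * t))) (at t)"
    by (simp add: W_fun_def [abs_def] x_def mult.commute)
  also have "real (Suc r) * t ^ r * W_series (Suc r) q x + t ^ Suc r * (D * (2 * s * t))
      = t ^ r * (2 * (x * D) + real (Suc r) * W_series (Suc r) q x)"
    by (simp add: x_def algebra_simps power2_eq_square)
  also have "\<dots> = 1 / t * lag (\<lambda>q. W_fun s (Suc r) q t) q + 2 / (1 - s * t\<^sup>2) * W_fun s r q t"
    unfolding ODE using t by (cases q) (simp_all add: W_fun_def x_def distrib_left)
  finally show ?thesis .
qed

lemma continuous_on_W_fun:
  assumes s: "\<bar>s\<bar> = 1"
  shows "continuous_on {0..<1} (W_fun s r q)"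
proof (rule continuous_at_imp_continuous_on, rule ballI)
  fix t :: real assume "t \<in> {0..<1}"
  then have "isCont (W_series r q) (s * t\<^sup>2)"
    by (intro isCont_W_series abs_times_square_less_1 s) auto
  then have "isCont (\<lambda>t. W_series r q (s * t\<^sup>2)) t"
    by (rule isCont_o2[where f = "\<lambda>t. s * t\<^sup>2", rotated]) (intro continuous_intros)
  then show "isCont (W_fun s r q) t"
    unfolding W_fun_def by (intro continuous_intros)
qed

lemma W_fun_eq_divided_power:
  assumes s: "\<bar>s\<bar> = 1" and L: "L 0 = 0" "continuous_on {0..<1} L"
    and L_deriv: "\<And>t. 0 < t \<Longrightarrow> t < 1 \<Longrightarrow> (L has_real_derivative 2 / (1 - s * t\<^sup>2)) (at t)"
    and t: "0 \<le> t" "t < 1"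
  shows "W_fun s r 0 t = divided_power r (L t)"
  using t
proof (induction r arbitrary: t)
  case 0
  then show ?case by (simp add: W_fun_0)
next
  case (Suc r)
  define f where "f t = W_fun s (Suc r) 0 t - divided_power (Suc r) (L t)" for t
  have "f t = f 0"
  proof (cases "t = 0")
    case False
    show ?thesis
    proof (rule DERIV_isconst2[of 0 t])
      have "continuous_on {0..<1} f"
        unfolding f_def by (intro continuous_intros continuous_on_W_fun s L)
      then show "continuous_on {0..t} f"
        by (rule continuous_on_subset) (use Suc.prems in auto)
      show "(f has_real_derivative 0) (at x)" if x: "0 < x" "x < t" for x
      proof -
        have "x < 1" using x Suc.prems by simp
        then show ?thesis
          using DERIV_diff[OF has_real_derivative_W_fun[OF s, of x r 0]
              has_real_derivative_divided_power[OF L_deriv, of x "Suc r"]] x Suc.IH[of x]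
          by (simp add: f_def [abs_def])
      qed
    qed (use False Suc.prems in auto)
  qed simp
  then show ?case by (simp add: f_def W_fun_Suc_at_0 L)
qed

lemma W_fun_eq_divided_power_arctan:
  assumes "0 \<le> t" "t < 1"
  shows "W_fun (-1) r 0 t = divided_power r (2 * arctan t)"
  using assms
  by (intro W_fun_eq_divided_power[where L = "\<lambda>t. 2 * arctan t"])
     (auto intro!: derivative_eq_intros continuous_intros simp: inverse_eq_divide)

lemma W_fun_eq_divided_power_ln:
  assumes "0 \<le> t" "t < 1"
  shows "W_fun 1 r 0 t = divided_power r (ln ((1 + t) / (1 - t)))"
proof (rule W_fun_eq_divided_power[where L = "\<lambda>t. ln ((1 + t) / (1 - t))"])
  show "continuous_on {0..<1} (\<lambda>t. ln ((1 + t) / (1 - t)) :: real)"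
    by (intro continuous_intros) auto
  show "((\<lambda>t. ln ((1 + t) / (1 - t))) has_real_derivative 2 / (1 - 1 * t\<^sup>2)) (at t)"
    if "0 < t" "t < 1" for t :: real
  proof -
    have "(1 - t) + (1 + t) = 2" "1 - t\<^sup>2 = (1 - t) * (1 + t)" "1 - t \<noteq> 0" "1 + t \<noteq> 0"
      using that by (simp_all add: power2_eq_square algebra_simps)
    then show ?thesis
      using that by (auto intro!: derivative_eq_intros simp: divide_simps power2_eq_square)
  qed
qed (use assms in auto)

section \<open>Logarithmic moments\<close>

definition log_power :: "nat \<Rightarrow> real \<Rightarrow> real" where
  "log_power q t = divided_power q (- ln t)"

lemma log_power_0 [simp]: "log_power 0 t = 1"
  by (simp add: log_power_def)

lemma log_power_at_1 [simp]: "log_power q 1 = of_bool (q = 0)"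
  by (simp add: log_power_def)

lemma log_power_nonneg:
  assumes "t \<in> {0..1}"
  shows "0 \<le> log_power q t"
  using assms by (cases "t = 0") (auto simp: log_power_def intro!: divided_power_nonneg)

lemma log_power_mult: "log_power k t * log_power l t = real ((k + l) choose k) * log_power (k + l) t"
  by (simp add: log_power_def divided_power_mult)

lemma has_real_derivative_log_power:
  assumes "0 < t"
  shows "(log_power q has_real_derivative - (1 / t * lag (\<lambda>q. log_power q t) q)) (at t)"
proof -
  have "((\<lambda>t. - ln t) has_real_derivative - (1 / t)) (at t)"
    using assms by (auto intro!: derivative_eq_intros)
  from has_real_derivative_divided_power[OF this, of q] show ?thesis
    by (simp add: log_power_def [abs_def])
qed

lemma continuous_on_times_log_power: "continuous_on {0..1} (\<lambda>t. t * log_power q t)"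
proof -
  have "continuous (at t within {0..1}) (\<lambda>t. t * log_power q t)" if t: "t \<in> {0..1}" for t
  proof (cases "t = 0")
    case True
    have "((\<lambda>t::real. t * ((- ln t) ^ q / fact q)) \<longlongrightarrow> 0) (at_right 0)"
      by real_asymp
    then show ?thesis
      using True by (simp add: continuous_within log_power_def divided_power_def at_within_Icc_at_right)
  next
    case False
    then have "isCont (\<lambda>t. t * log_power q t) t"
      using t by (intro continuous_intros DERIV_isCont[OF has_real_derivative_log_power]) auto
    then show ?thesis by (rule continuous_at_imp_continuous_at_within)
  qed
  then show ?thesis by (simp add: continuous_on_eq_continuous_within)
qed

lemma has_integral_derivative_Icc:
  fixes F f :: "real \<Rightarrow> real"
  assumes "a \<le> b" "continuous_on {a..b} F"
    and "\<And>x. a < x \<Longrightarrow> x < b \<Longrightarrow> (F has_real_derivative f x) (at x)"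
  shows "(f has_integral F b - F a) {a..b}"
  using assms by (intro fundamental_theorem_of_calculus_interior)
    (auto simp flip: has_real_derivative_iff_has_vector_derivative)

lemma has_integral_log_power_by_parts:
  assumes "continuous_on {0..1} g" and G: "\<And>t. t \<in> {0..1} \<Longrightarrow> G t = t * g t"
    and G_deriv: "\<And>t. 0 < t \<Longrightarrow> t < 1 \<Longrightarrow> (G has_real_derivative G' t) (at t)"
    and int: "((\<lambda>t. log_power q t * g t) has_integral I) {0..1}"
  shows "((\<lambda>t. log_power (Suc q) t * G' t) has_integral I) {0..1}"
proof -
  define F where "F t = log_power (Suc q) t * G t" for t
  have "((\<lambda>t. log_power (Suc q) t * G' t - log_power q t * g t) has_integral F 1 - F 0) {0..1}"
  proof (rule has_integral_derivative_Icc)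
    have "continuous_on {0..1} (\<lambda>t. (t * log_power (Suc q) t) * g t)"
      by (intro continuous_on_mult continuous_on_times_log_power assms(1))
    then show "continuous_on {0..1} F"
      by (rule continuous_on_eq) (simp add: F_def G)
    show "(F has_real_derivative log_power (Suc q) t * G' t - log_power q t * g t) (at t)"
      if t: "0 < t" "t < 1" for t
      using DERIV_mult[OF has_real_derivative_log_power[OF t(1), of "Suc q"] G_deriv[OF t]] t
      by (simp add: F_def [abs_def] G mult.commute)
  qed simp
  from has_integral_add[OF this int] show ?thesis
    by (simp add: F_def G)
qed

lemma has_integral_log_power_times_power:
  "((\<lambda>t. log_power q t * t ^ n) has_integral 1 / real (Suc n) ^ Suc q) {0..1}"
proof -
  have deriv: "((\<lambda>t. t * (t ^ n / real (Suc n))) has_real_derivative t ^ n) (at t)" for t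
    using DERIV_cdivide[OF DERIV_pow[of "Suc n" t], of "real (Suc n)"] by simp
  show ?thesis
  proof (induction q)
    case 0
    have "((\<lambda>t. t ^ n) has_integral 1 * (1 ^ n / real (Suc n)) - 0 * (0 ^ n / real (Suc n))) {0..1}"
      by (intro has_integral_derivative_Icc continuous_intros deriv) auto
    then show ?case by simp
  next
    case (Suc q)
    show ?case
    proof (rule has_integral_log_power_by_parts[where G = "\<lambda>t. t * (t ^ n / real (Suc n))"])
      show "((\<lambda>t. log_power q t * (t ^ n / real (Suc n)))
          has_integral 1 / real (Suc n) ^ Suc (Suc q)) {0..1}"
        using has_integral_divide[OF Suc.IH, of "real (Suc n)"] by (simp add: mult.commute)
    qed (simp_all only: deriv, intro continuous_intros, simp)
  qed
qed

lemma integrable_log_power_times: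
  assumes "continuous_on {0..1} g"
  shows "(\<lambda>t. log_power q t * g t) integrable_on {0..1}"
proof -
  have "log_power q integrable_on {0..1}"
    using has_integral_log_power_times_power[of q 0] by auto
  then have "log_power q absolutely_integrable_on {0..1}"
    by (intro nonnegative_absolutely_integrable_1 log_power_nonneg)
  moreover have "g \<in> borel_measurable (lebesgue_on {0..1})"
    using assms by (intro continuous_imp_measurable_on_sets_lebesgue) auto
  moreover have "bounded (g ` {0..1})"
    using assms by (intro compact_imp_bounded compact_continuous_image) auto
  ultimately have "(\<lambda>t. g t * log_power q t) absolutely_integrable_on {0..1}"
    by (intro absolutely_integrable_bounded_measurable_product_real) auto
  then show ?thesis
    by (simp add: absolutely_integrable_on_def mult.commute)
qed

lemma abs_integral_diff_alternating_sum_le: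
  "\<bar>integral {0..1} (\<lambda>t. log_power q t * (1 / (1 + t))) - (\<Sum>n<N. (-1) ^ n / real (Suc n) ^ Suc q)\<bar>
     \<le> 1 / real (Suc N) ^ Suc q" (is "\<bar>?I - ?S\<bar> \<le> _")
proof -
  let ?R = "\<lambda>t. log_power q t * ((- t) ^ N / (1 + t))"
  have "((\<lambda>t. log_power q t * (1 / (1 + t))) has_integral ?I) {0..1}"
    by (intro integrable_integral integrable_log_power_times continuous_intros) auto
  then have "((\<lambda>t. log_power q t * (1 / (1 + t)) - (\<Sum>n<N. (-1) ^ n * (log_power q t * t ^ n))) has_integral
      ?I - (\<Sum>n<N. (-1) ^ n * (1 / real (Suc n) ^ Suc q))) {0..1}"
    by (intro has_integral_diff has_integral_sum has_integral_mult_right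
        has_integral_log_power_times_power)
       auto
  moreover have "log_power q t * (1 / (1 + t)) - (\<Sum>n<N. (-1) ^ n * (log_power q t * t ^ n)) = ?R t"
    if "t \<in> {0..1}" for t
  proof -
    have "(\<Sum>n<N. (-1) ^ n * (log_power q t * t ^ n)) = log_power q t * (\<Sum>n<N. (- t) ^ n)"
      by (simp add: sum_distrib_left power_minus[of t] ac_simps)
    also have "(\<Sum>n<N. (- t) ^ n) = (1 - (- t) ^ N) / (1 + t)"
      using that by (subst sum_gp_strict) auto
    finally show ?thesis by (simp add: diff_divide_distrib right_diff_distrib)
  qed
  ultimately have R: "(?R has_integral ?I - ?S) {0..1}"
    by (subst (asm) has_integral_cong) auto
  have "norm (?R t) \<le> log_power q t * t ^ N" if t: "t \<in> {0..1}" for t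
  proof -
    have "norm (?R t) = log_power q t * (t ^ N / (1 + t))"
      using t log_power_nonneg[OF t, of q] by (simp add: abs_mult power_abs)
    also have "\<dots> \<le> log_power q t * (t ^ N / 1)"
      using t log_power_nonneg[OF t] by (intro mult_left_mono divide_left_mono) auto
    finally show ?thesis by simp
  qed
  then have "norm (integral {0..1} ?R) \<le> integral {0..1} (\<lambda>t. log_power q t * t ^ N)"
    using R has_integral_log_power_times_power by (intro integral_norm_bound_integral) blast+
  then show ?thesis
    using integral_unique[OF R] integral_unique[OF has_integral_log_power_times_power[of q N]] by simp
qed

lemma has_integral_zetabar: "((\<lambda>t. log_power q t * (1 / (1 + t))) has_integral zetabar (Suc q)) {0..1}"
proof -
  define I where "I = integral {0..1} (\<lambda>t. log_power q t * (1 / (1 + t)))"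
  have remainder_le: "\<bar>I - (\<Sum>n<N. (-1) ^ n / real (Suc n) ^ Suc q)\<bar> \<le> 1 / real (Suc N)" for N
  proof -
    have "\<bar>I - (\<Sum>n<N. (-1) ^ n / real (Suc n) ^ Suc q)\<bar> \<le> 1 / real (Suc N) ^ Suc q"
      unfolding I_def by (rule abs_integral_diff_alternating_sum_le)
    also have "\<dots> \<le> 1 / real (Suc N)"
      using power_increasing[of 1 "Suc q" "real (Suc N)"] by (intro divide_left_mono) auto
    finally show ?thesis .
  qed
  have "(\<lambda>N. I - (\<Sum>n<N. (-1) ^ n / real (Suc n) ^ Suc q)) \<longlonglongrightarrow> 0"
  proof (rule Lim_null_comparison)
    show "(\<lambda>N. 1 / real (Suc N)) \<longlonglongrightarrow> 0" by real_asymp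
  qed (use remainder_le in auto)
  then have "(\<lambda>n. (-1) ^ n / real (n + 1) ^ Suc q) sums I"
    unfolding sums_def using Lim_transform2[OF tendsto_const[of I]] by simp
  moreover have "((\<lambda>t. log_power q t * (1 / (1 + t))) has_integral I) {0..1}"
    unfolding I_def by (intro integrable_integral integrable_log_power_times continuous_intros) auto
  ultimately show ?thesis
    by (simp add: zetabar_def sums_iff)
qed

definition cayley :: "real \<Rightarrow> real" where
  "cayley t = (1 - t) / (1 + t)"

lemma cayley_nonneg_less_1: "0 < t \<Longrightarrow> t < 1 \<Longrightarrow> 0 \<le> cayley t \<and> cayley t < 1"
  by (simp add: cayley_def)

lemma continuous_on_cayley [continuous_intros]: "continuous_on {0..1} cayley"
  unfolding cayley_def [abs_def] by (intro continuous_intros) auto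

definition cayley_kernel :: "nat \<Rightarrow> real \<Rightarrow> real" where
  "cayley_kernel N t = real N * cayley t ^ (N - 1) * (2 / (1 + t)\<^sup>2)"

lemma continuous_on_cayley_kernel: "continuous_on {0..1} (cayley_kernel N)"
  unfolding cayley_kernel_def [abs_def] by (intro continuous_intros) auto

lemma has_real_derivative_cayley_power:
  assumes "-1 < t"
  shows "((\<lambda>t. cayley t ^ N) has_real_derivative - cayley_kernel N t) (at t)"
proof -
  have "(cayley has_real_derivative (- 2 / (1 + t)\<^sup>2)) (at t)"
    unfolding cayley_def [abs_def] using assms
    by (auto intro!: derivative_eq_intros simp: divide_simps power2_eq_square)
  from DERIV_power[OF this, of N] show ?thesis by (simp add: cayley_kernel_def ac_simps)
qed

text \<open>In the variable \<open>u = cayley t\<close> this is the integral over \<open>[0, 1]\<close> of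
  \<open>N * u ^ (N - 1) * ln ((1 + u) / (1 - u)) ^ q / q!\<close>.\<close>
definition log_moment :: "nat \<Rightarrow> nat \<Rightarrow> real" where
  "log_moment q N = integral {0..1} (\<lambda>t. log_power q t * cayley_kernel N t)"

lemma has_integral_log_moment:
  "((\<lambda>t. log_power q t * cayley_kernel N t) has_integral log_moment q N) {0..1}"
  unfolding log_moment_def
  by (intro integrable_integral integrable_log_power_times continuous_on_cayley_kernel)

lemma log_moment_at_0: "log_moment q 0 = 0"
  by (simp add: log_moment_def cayley_kernel_def)

lemma log_moment_0:
  assumes "0 < N"
  shows "log_moment 0 N = 1"
proof -
  have "(cayley_kernel N has_integral - (cayley 1 ^ N) - - (cayley 0 ^ N)) {0..1}"
  proof (rule has_integral_derivative_Icc)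
    show "((\<lambda>t. - (cayley t ^ N)) has_real_derivative cayley_kernel N t) (at t)" if "0 < t" for t
      using DERIV_minus[OF has_real_derivative_cayley_power[of t N]] that by simp
  qed (auto intro!: continuous_intros)
  then show ?thesis
    using assms by (simp add: log_moment_def cayley_def integral_unique)
qed

lemma log_moment_Suc_at_1: "log_moment (Suc q) 1 = 2 * zetabar (Suc q)"
proof -
  have "((\<lambda>t. log_power (Suc q) t * cayley_kernel 1 t) has_integral 2 * zetabar (Suc q)) {0..1}"
  proof (rule has_integral_log_power_by_parts)
    show "1 - cayley t ^ 1 = t * (2 * (1 / (1 + t)))" if "t \<in> {0..1}" for t
      using that by (simp add: cayley_def field_simps)
    show "((\<lambda>t. 1 - cayley t ^ 1) has_real_derivative cayley_kernel 1 t) (at t)" if "0 < t" for t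
      using DERIV_diff[OF DERIV_const has_real_derivative_cayley_power[of t 1], of 1] that by simp
    show "((\<lambda>t. log_power q t * (2 * (1 / (1 + t)))) has_integral 2 * zetabar (Suc q)) {0..1}"
      unfolding mult.left_commute[of _ "2::real"]
      by (intro has_integral_mult_right has_integral_zetabar)
  qed (auto intro!: continuous_intros)
  then show ?thesis
    by (rule has_integral_unique[OF has_integral_log_moment])
qed

lemma log_moment_Suc_Suc:
  "log_moment (Suc q) (N + 2) = log_moment (Suc q) N + 2 / real (N + 1) * log_moment q (N + 1)"
proof -
  have "((\<lambda>t. log_power (Suc q) t * (cayley_kernel (N + 2) t - cayley_kernel N t))
      has_integral 2 / real (N + 1) * log_moment q (N + 1)) {0..1}"
  proof (rule has_integral_log_power_by_parts)
    show "cayley t ^ N - cayley t ^ (N + 2) = t * (cayley t ^ N * (4 / (1 + t)\<^sup>2))"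
      if "t \<in> {0..1}" for t
    proof -
      have "1 - (cayley t)\<^sup>2 = t * (4 / (1 + t)\<^sup>2)"
        using that
        by (simp add: cayley_def power_divide divide_simps) (simp add: power2_eq_square algebra_simps)
      moreover have "cayley t ^ N - cayley t ^ (N + 2) = cayley t ^ N * (1 - (cayley t)\<^sup>2)"
        by (simp add: power_add right_diff_distrib power2_eq_square)
      ultimately show ?thesis by (simp add: mult.left_commute)
    qed
    show "((\<lambda>t. cayley t ^ N - cayley t ^ (N + 2)) has_real_derivative
        cayley_kernel (N + 2) t - cayley_kernel N t) (at t)" if "0 < t" for t
      using DERIV_diff[OF has_real_derivative_cayley_power[of t N]
          has_real_derivative_cayley_power[of t "N + 2"]] that by simp
    have kernel: "log_power q t * (cayley t ^ N * (4 / (1 + t)\<^sup>2))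
        = 2 / real (N + 1) * (log_power q t * cayley_kernel (N + 1) t)" for t
      by (simp add: cayley_kernel_def divide_simps)
    show "((\<lambda>t. log_power q t * (cayley t ^ N * (4 / (1 + t)\<^sup>2)))
        has_integral 2 / real (N + 1) * log_moment q (N + 1)) {0..1}"
      unfolding kernel by (intro has_integral_mult_right has_integral_log_moment)
  qed (auto intro!: continuous_intros)
  moreover have "((\<lambda>t. log_power (Suc q) t * (cayley_kernel (N + 2) t - cayley_kernel N t))
      has_integral log_moment (Suc q) (N + 2) - log_moment (Suc q) N) {0..1}"
    unfolding right_diff_distrib by (intro has_integral_diff has_integral_log_moment)
  ultimately show ?thesis by (auto dest: has_integral_unique)
qed

section \<open>Integral representation\<close>

definition arctan_power :: "nat \<Rightarrow> real \<Rightarrow> real" where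
  "arctan_power l t = divided_power l (pi / 2 - 2 * arctan t)"

lemma arctan_power_at_1: "arctan_power l 1 = of_bool (l = 0)"
  by (simp add: arctan_power_def arctan_one)

lemma has_real_derivative_arctan_power:
  "(arctan_power l has_real_derivative - (2 / (1 + t\<^sup>2) * lag (\<lambda>l. arctan_power l t) l)) (at t)"
proof -
  have "((\<lambda>t. pi / 2 - 2 * arctan t) has_real_derivative - (2 / (1 + t\<^sup>2))) (at t)"
    by (auto intro!: derivative_eq_intros simp: inverse_eq_divide)
  from has_real_derivative_divided_power[OF this, of l] show ?thesis
    by (simp add: arctan_power_def [abs_def])
qed

lemma continuous_on_arctan_power: "continuous_on S (arctan_power l)"
  unfolding arctan_power_def [abs_def] by (intro continuous_intros)

lemma arctan_power_eq_cayley: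
  assumes "0 \<le> t" "t < 1"
  shows "arctan_power l t = divided_power l (2 * arctan (cayley t))"
proof -
  have "arctan 1 + arctan (- t) = arctan (cayley t)"
    using arctan_add[of 1 "- t"] assms by (simp add: cayley_def)
  then have "2 * arctan (cayley t) = pi / 2 - 2 * arctan t"
    by (simp add: arctan_one arctan_minus)
  then show ?thesis by (simp add: arctan_power_def)
qed

text \<open>The convolution in \<open>q\<close> removes the term with \<open>1 / t\<close> from the differential equation of \<open>W_fun\<close>.\<close>
definition W_log_convolution :: "nat \<Rightarrow> nat \<Rightarrow> real \<Rightarrow> real" where
  "W_log_convolution q r t = (\<Sum>i\<le>q. W_fun (-1) r i t * log_power (q - i) t)"

lemma W_log_convolution_0: "W_log_convolution q 0 t = log_power q t"
proof -
  have "W_log_convolution q 0 t = (\<Sum>i\<le>q. if i = 0 then log_power q t else 0)"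
    unfolding W_log_convolution_def by (intro sum.cong) (auto simp: W_fun_0)
  then show ?thesis by simp
qed

lemma W_log_convolution_Suc_at_0: "W_log_convolution q (Suc r) 0 = 0"
  by (simp add: W_log_convolution_def W_fun_Suc_at_0)

lemma W_log_convolution_at_1: "W_log_convolution q r 1 = W_series r q (-1)"
proof -
  have "W_log_convolution q r 1 = (\<Sum>i\<le>q. if i = q then W_series r q (-1) else 0)"
    unfolding W_log_convolution_def by (intro sum.cong) (auto simp: W_fun_def)
  then show ?thesis by simp
qed

lemma has_real_derivative_W_log_convolution:
  assumes "0 < t" "t < 1"
  shows "(W_log_convolution q (Suc r) has_real_derivative 2 / (1 + t\<^sup>2) * W_log_convolution q r t) (at t)"
proof -
  have "(W_log_convolution q (Suc r) has_real_derivative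
      (\<Sum>i\<le>q. 2 / (1 + t\<^sup>2) * W_fun (-1) r i t * log_power (q - i) t)) (at t)"
    unfolding W_log_convolution_def [abs_def]
  proof (rule has_real_derivative_convolution)
    show "(W_fun (-1) (Suc r) i has_real_derivative
        1 / t * lag (\<lambda>i. W_fun (-1) (Suc r) i t) i + 2 / (1 + t\<^sup>2) * W_fun (-1) r i t) (at t)" for i
      using has_real_derivative_W_fun[of "-1" t r i] assms by simp
    show "(log_power i has_real_derivative - (1 / t * lag (\<lambda>i. log_power i t) i)) (at t)" for i
      using assms by (intro has_real_derivative_log_power)
  qed
  then show ?thesis
    by (simp add: W_log_convolution_def sum_distrib_left mult.assoc)
qed

lemma continuous_on_W_log_convolution: "continuous_on {0..1} (W_log_convolution q (Suc r))"
proof -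
  have "continuous_on {0..1} (\<lambda>t. W_series (Suc r) i (- (t\<^sup>2)))" for i
    by (rule continuous_on_compose2[OF continuous_on_W_series_uminus])
       (auto intro!: continuous_intros simp: power_le_one)
  then have "continuous_on {0..1} (\<lambda>t. \<Sum>i\<le>q.
      (t ^ r * W_series (Suc r) i (- (t\<^sup>2))) * (t * log_power (q - i) t))"
    by (intro continuous_on_sum continuous_on_mult continuous_on_times_log_power continuous_on_power
        continuous_on_id)
  then show ?thesis
    by (rule continuous_on_eq) (simp add: W_log_convolution_def W_fun_def ac_simps)
qed

lemma has_integral_W_series:
  "((\<lambda>t. log_power q t * (2 / (1 + t\<^sup>2) * arctan_power l t)) has_integral W_series (Suc l) q (-1)) {0..1}"
proof -
  define F where "F t = (\<Sum>j\<le>l. W_log_convolution q (Suc j) t * arctan_power (l - j) t)" for t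
  have "((\<lambda>t. log_power q t * (2 / (1 + t\<^sup>2) * arctan_power l t)) has_integral F 1 - F 0) {0..1}"
  proof (rule has_integral_derivative_Icc)
    show "continuous_on {0..1} F"
      unfolding F_def
      by (intro continuous_on_sum continuous_on_mult continuous_on_W_log_convolution
          continuous_on_arctan_power)
    fix t :: real assume t: "0 < t" "t < 1"
    let ?c = "2 / (1 + t\<^sup>2)"
    let ?g = "\<lambda>j. if j = 0 then ?c * log_power q t else 0"
    have "(F has_real_derivative (\<Sum>j\<le>l. ?g j * arctan_power (l - j) t)) (at t)"
      unfolding F_def [abs_def]
    proof (rule has_real_derivative_convolution[OF _ has_real_derivative_arctan_power])
      show "(W_log_convolution q (Suc j) has_real_derivative
          ?c * lag (\<lambda>j. W_log_convolution q (Suc j) t) j + ?g j) (at t)" for j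
        using has_real_derivative_W_log_convolution[OF t, of q j]
        by (cases j) (simp_all add: W_log_convolution_0)
    qed
    also have "(\<Sum>j\<le>l. ?g j * arctan_power (l - j) t)
        = (\<Sum>j\<le>l. if j = 0 then ?c * log_power q t * arctan_power l t else 0)"
      by (intro sum.cong) auto
    also have "\<dots> = log_power q t * (?c * arctan_power l t)" by simp
    finally show "(F has_real_derivative log_power q t * (?c * arctan_power l t)) (at t)" .
  qed simp
  moreover have "F 1 = W_series (Suc l) q (-1)"
  proof -
    have "F 1 = (\<Sum>j\<le>l. if j = l then W_series (Suc l) q (-1) else 0)"
      unfolding F_def by (intro sum.cong) (auto simp: W_log_convolution_at_1 arctan_power_at_1)
    then show ?thesis by simp
  qed
  moreover have "F 0 = 0" by (simp add: F_def W_log_convolution_Suc_at_0)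
  ultimately show ?thesis by simp
qed

section \<open>Expansion in logarithmic moments\<close>

definition alt_W_sum :: "nat \<Rightarrow> nat \<Rightarrow> real \<Rightarrow> real" where
  "alt_W_sum l N u = (\<Sum>n<N. (-1) ^ n * ((\<Sum>j\<le>n. W_coeff l 0 j) * u ^ (2 * n + l)))"

lemma abs_alt_W_sum_le:
  assumes u: "0 \<le> u" "u < 1"
  shows "\<bar>alt_W_sum l N u\<bar> \<le> W_fun 1 l 0 u"
proof -
  have "\<bar>alt_W_sum l N u\<bar> \<le> (\<Sum>n<N. W_coeff l 0 n * u ^ (2 * n + l))"
    unfolding alt_W_sum_def using u
    by (intro abs_alternating_partial_sums_le W_coeff_nonneg)
       (auto intro!: power_decreasing simp del: power_Suc)
  also have "\<dots> = u ^ l * (\<Sum>n<N. W_coeff l 0 n * (u\<^sup>2) ^ n)"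
    unfolding sum_distrib_left by (intro sum.cong refl) (simp add: power_add power_mult)
  also have "\<dots> \<le> u ^ l * W_series l 0 (u\<^sup>2)"
    unfolding W_series_def using u
    by (intro mult_left_mono sum_le_suminf summable_W_coeff_power)
       (auto simp: W_coeff_nonneg power_less_one_iff abs_square_less_1)
  finally show ?thesis by (simp add: W_fun_def)
qed

lemma alt_W_sum_tendsto:
  assumes u: "0 \<le> u" "u < 1"
  shows "(\<lambda>N. alt_W_sum l N u) \<longlonglongrightarrow> W_fun (-1) l 0 u / (1 + u\<^sup>2)"
proof -
  have "\<bar>- (u\<^sup>2)\<bar> < 1" using u by (simp add: abs_square_less_1)
  from sums_mult[OF sums_partial_sums_W_coeff_power[OF this, of l 0], of "u ^ l"]
  have "(\<lambda>n. u ^ l * ((\<Sum>j\<le>n. W_coeff l 0 j) * (- (u\<^sup>2)) ^ n)) sums (W_fun (-1) l 0 u / (1 + u\<^sup>2))"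
    by (simp add: W_fun_def)
  also have "(\<lambda>n. u ^ l * ((\<Sum>j\<le>n. W_coeff l 0 j) * (- (u\<^sup>2)) ^ n))
      = (\<lambda>n. (-1) ^ n * ((\<Sum>j\<le>n. W_coeff l 0 j) * u ^ (2 * n + l)))"
    by (simp add: fun_eq_iff power_minus[of "u\<^sup>2"] power_add power_mult)
  finally show ?thesis unfolding alt_W_sum_def sums_def .
qed

lemma W_coeff_times_cayley_kernel:
  "W_coeff (Suc l) 0 n * cayley_kernel (2 * n + Suc l) t
     = 4 / (1 + t)\<^sup>2 * ((\<Sum>j\<le>n. W_coeff l 0 j) * cayley t ^ (2 * n + l))"
proof -
  have "W_coeff (Suc l) 0 n * cayley_kernel (2 * n + Suc l) t
      = (real (2 * n + l + 1) * W_coeff (Suc l) 0 n) * (cayley t ^ (2 * n + l) * (2 / (1 + t)\<^sup>2))"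
    by (simp add: cayley_kernel_def)
  then show ?thesis
    unfolding W_coeff_Suc by simp
qed

lemma has_integral_alt_W_sum:
  "((\<lambda>t. log_power q t * (4 / (1 + t)\<^sup>2 * alt_W_sum l N (cayley t))) has_integral
     (\<Sum>n<N. (-1) ^ n * (W_coeff (Suc l) 0 n * log_moment q (2 * n + Suc l)))) {0..1}"
proof -
  have "((\<lambda>t. \<Sum>n<N. (-1) ^ n * (W_coeff (Suc l) 0 n * (log_power q t * cayley_kernel (2 * n + Suc l) t)))
      has_integral (\<Sum>n<N. (-1) ^ n * (W_coeff (Suc l) 0 n * log_moment q (2 * n + Suc l)))) {0..1}"
    by (intro has_integral_sum has_integral_mult_right has_integral_log_moment) auto
  moreover have "(-1) ^ n * (W_coeff (Suc l) 0 n * (log_power q t * cayley_kernel (2 * n + Suc l) t))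
      = log_power q t * (4 / (1 + t)\<^sup>2 * ((-1) ^ n * ((\<Sum>j\<le>n. W_coeff l 0 j) * cayley t ^ (2 * n + l))))"
    for n t
    using W_coeff_times_cayley_kernel[of l n t]
    by (metis (no_types, opaque_lifting) mult.assoc mult.left_commute)
  ultimately show ?thesis
    by (simp only: alt_W_sum_def sum_distrib_left)
qed

lemma W_fun_1_cayley:
  assumes "0 < t" "t < 1"
  shows "W_fun 1 l 0 (cayley t) = log_power l t"
proof -
  have "(1 + cayley t) / (1 - cayley t) = 1 / t"
    using assms by (simp add: cayley_def divide_simps)
  then show ?thesis
    using cayley_nonneg_less_1[OF assms] assms
    by (simp add: W_fun_eq_divided_power_ln log_power_def ln_div)
qed

lemma W_fun_uminus_1_cayley:
  assumes "0 < t" "t < 1"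
  shows "4 / (1 + t)\<^sup>2 * (W_fun (-1) l 0 (cayley t) / (1 + (cayley t)\<^sup>2))
      = 2 / (1 + t\<^sup>2) * arctan_power l t"
proof -
  have "(1 + t)\<^sup>2 * (1 + (cayley t)\<^sup>2) = (1 + t)\<^sup>2 + (1 - t)\<^sup>2"
    using assms by (simp add: cayley_def power_divide distrib_left)
  also have "\<dots> = 2 * (1 + t\<^sup>2)"
    by (simp add: power2_eq_square algebra_simps)
  finally have denominator: "(1 + t)\<^sup>2 * (1 + (cayley t)\<^sup>2) = 2 * (1 + t\<^sup>2)" .
  have "W_fun (-1) l 0 (cayley t) = arctan_power l t"
    using cayley_nonneg_less_1[OF assms] assms
    by (simp add: W_fun_eq_divided_power_arctan arctan_power_eq_cayley)
  moreover have "4 * x / (2 * y) = 2 / y * x" for x y :: real by simp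
  ultimately show ?thesis
    by (simp only: times_divide_times_eq denominator)
qed

lemma sums_W_coeff_log_moment:
  "(\<lambda>n. (-1) ^ n * (W_coeff (Suc l) 0 n * log_moment q (2 * n + Suc l))) sums W_series (Suc l) q (-1)"
proof -
  let ?f = "\<lambda>N t. log_power q t * (4 / (1 + t)\<^sup>2 * alt_W_sum l N (cayley t))"
  let ?g = "\<lambda>t. log_power q t * (2 / (1 + t\<^sup>2) * arctan_power l t)"
  let ?h = "\<lambda>t. real ((q + l) choose q) * (log_power (q + l) t * (4 / (1 + t)\<^sup>2))"
  have "(\<lambda>N. integral {0<..<1} (?f N)) \<longlonglongrightarrow> integral {0<..<1} ?g"
  proof (rule dominated_convergence(2))
    show "?f N integrable_on {0<..<1}" for N
      using has_integral_alt_W_sum unfolding integrable_on_Icc_iff_Ioo [symmetric] by blast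
    show "?h integrable_on {0<..<1}"
      unfolding integrable_on_Icc_iff_Ioo [symmetric]
      by (intro integrable_on_mult_right integrable_log_power_times continuous_intros) auto
    fix t :: real assume "t \<in> {0<..<1}"
    then have t: "0 < t" "t < 1" by auto
    note cayley = cayley_nonneg_less_1[OF t, THEN conjunct1] cayley_nonneg_less_1[OF t, THEN conjunct2]
    show "norm (?f N t) \<le> ?h t" for N
    proof -
      have "\<bar>alt_W_sum l N (cayley t)\<bar> \<le> log_power l t"
        using abs_alt_W_sum_le[OF cayley] by (simp add: W_fun_1_cayley[OF t])
      then have "norm (?f N t) \<le> log_power q t * (4 / (1 + t)\<^sup>2 * log_power l t)"
        using t log_power_nonneg[of t q] unfolding real_norm_def abs_mult by (intro mult_mono) auto
      also have "\<dots> = log_power q t * log_power l t * (4 / (1 + t)\<^sup>2)" by simp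
      finally show ?thesis by (simp only: log_power_mult mult.assoc)
    qed
    show "(\<lambda>N. ?f N t) \<longlonglongrightarrow> ?g t"
      unfolding W_fun_uminus_1_cayley[OF t, symmetric]
      by (intro tendsto_intros alt_W_sum_tendsto cayley)
  qed
  then show ?thesis
    unfolding integral_open_interval_real [symmetric] integral_unique[OF has_integral_alt_W_sum]
      integral_unique[OF has_integral_W_series] sums_def .
qed

section \<open>Harmonic sums with indices of alternating parity\<close>

text \<open>\<open>alt_harm l N\<close> is the sum of \<open>2 ^ l / (M\<^sub>1 \<dots> M\<^sub>l)\<close> over \<open>0 < M\<^sub>1 < \<dots> < M\<^sub>l < N\<close> where consecutive
  terms of \<open>M\<^sub>1, \<dots>, M\<^sub>l, N\<close> differ in parity.\<close>
fun alt_harm :: "nat \<Rightarrow> nat \<Rightarrow> real" where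
  "alt_harm 0 N = 1"
| "alt_harm (Suc l) 0 = 0"
| "alt_harm (Suc l) (Suc 0) = 0"
| "alt_harm (Suc l) (Suc (Suc N)) = alt_harm (Suc l) N + 2 / real (N + 1) * alt_harm l (N + 1)"

lemma alt_harm_Suc_at_1: "alt_harm (Suc l) 1 = 0"
  by (simp only: One_nat_def alt_harm.simps)

lemma alt_harm_eq_0: "0 < l \<Longrightarrow> N \<le> l \<Longrightarrow> alt_harm l N = 0"
proof (induction l N rule: alt_harm.induct)
  case (4 l N)
  then show ?case by (cases "l = 0") auto
qed auto

lemma alt_harm_Suc_even:
  "alt_harm (Suc l) (2 * n) = (\<Sum>m=1..n. 2 / (2 * real m - 1) * alt_harm l (2 * m - 1))"
  by (induction n) (simp_all add: algebra_simps)

lemma alt_harm_Suc_odd: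
  assumes "0 < n"
  shows "alt_harm (Suc l) (2 * n - 1) = (\<Sum>m=1..<n. 2 / (2 * real m) * alt_harm l (2 * m))"
  using assms
proof (induction n rule: nat_induct_non_zero)
  case (Suc n)
  have "2 * Suc n - 1 = Suc (Suc (2 * n - 1))" "2 * n - 1 + 1 = 2 * n" using Suc.hyps by auto
  then have "alt_harm (Suc l) (2 * Suc n - 1)
      = alt_harm (Suc l) (2 * n - 1) + 2 / (2 * real n) * alt_harm l (2 * n)"
    by (simp only: alt_harm.simps)
  also have "\<dots> = (\<Sum>m=1..<Suc n. 2 / (2 * real m) * alt_harm l (2 * m))"
    using Suc by simp
  finally show ?case .
qed simp

lemma partial_sums_W_coeff_eq_alt_harm: "(\<Sum>j\<le>n. W_coeff l 0 j) = alt_harm l (2 * n + l + 1)"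
proof (induction l arbitrary: n)
  case 0
  show ?case by (induction n) (simp_all add: W_coeff_0)
next
  case (Suc l)
  have W_coeff_eq: "W_coeff (Suc l) 0 n = 2 / real (2 * n + l + 1) * alt_harm l (2 * n + l + 1)" for n
    using W_coeff_Suc[of n l 0] unfolding Suc.IH by (simp add: field_simps)
  show ?case
  proof (induction n)
    case 0
    then show ?case using W_coeff_eq[of 0] alt_harm_eq_0[of "Suc l" l] by simp
  next
    case (Suc n)
    then show ?case using W_coeff_eq[of "Suc n"] by simp
  qed
qed

lemma W_coeff_Suc_eq_alt_harm:
  "W_coeff (Suc l) 0 n = 2 / real (2 * n + l + 1) * alt_harm l (2 * n + l + 1)"
  using W_coeff_Suc[of n l 0] unfolding partial_sums_W_coeff_eq_alt_harm by (simp add: field_simps)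

definition parity_le :: "nat \<Rightarrow> nat \<Rightarrow> nat \<Rightarrow> bool" where
  "parity_le i x y \<longleftrightarrow> (if even i then x \<le> y else x < y)"

lemma parity_le_imp_le: "parity_le i x y \<Longrightarrow> x \<le> y"
  by (auto simp: parity_le_def split: if_splits)

definition parity_weight :: "nat \<Rightarrow> nat \<Rightarrow> real" where
  "parity_weight i x = (if even i then 2 * real x - 1 else 2 * real x)"

text \<open>With \<open>e = 0\<close> and \<open>e = 1\<close> these are the index sets and the values of the T- and S-harmonic sums; the
  upper bound \<open>n\<close> is treated as one more entry of the list.\<close>
definition TS_idx :: "nat \<Rightarrow> nat \<Rightarrow> nat \<Rightarrow> nat list set" where
  "TS_idx e l n = {ns. length ns = l \<and>
     (\<forall>i<l. 0 < ns ! i \<and> parity_le (i + e) (ns ! i) ((ns @ [n]) ! (i + 1)))}"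

definition TS_sum :: "nat \<Rightarrow> nat \<Rightarrow> nat \<Rightarrow> real" where
  "TS_sum e n l = (\<Sum>ns\<in>TS_idx e l n. 2 ^ l / (\<Prod>i<l. parity_weight (i + e) (ns ! i)))"

lemma mem_TS_idx_iff:
  "ns \<in> TS_idx e l n \<longleftrightarrow> length ns = l \<and> (0 < l \<longrightarrow> 0 < ns ! 0) \<and>
     (\<forall>i. i + 1 < l \<longrightarrow> parity_le (i + e) (ns ! i) (ns ! (i + 1))) \<and>
     (0 < l \<longrightarrow> parity_le (l - 1 + e) (ns ! (l - 1)) n)"
proof (cases "length ns = l \<and> 0 < l")
  case True
  then obtain k where len: "length ns = l" and l: "l = Suc k" by (cases l) auto
  let ?chain = "\<forall>i<k. parity_le (i + e) (ns ! i) (ns ! (i + 1))"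
    and ?last = "parity_le (k + e) (ns ! k) n"
  have nth: "(ns @ [n]) ! (k + 1) = n" "\<And>i. i < k \<Longrightarrow> (ns @ [n]) ! (i + 1) = ns ! (i + 1)"
    using len l by (simp_all add: nth_append)
  have pos: "0 < ns ! i" if "0 < ns ! 0" "?chain" "i \<le> k" for i
    using \<open>i \<le> k\<close>
  proof (induction i)
    case (Suc i)
    then have "0 < ns ! i" and "parity_le (i + e) (ns ! i) (ns ! (i + 1))"
      using that(2) by auto
    then show ?case using parity_le_imp_le[of "i + e"] by fastforce
  qed (use that(1) in simp)
  have "ns \<in> TS_idx e l n \<longleftrightarrow> (\<forall>i\<le>k. 0 < ns ! i) \<and> ?chain \<and> ?last"
    using len nth by (auto simp: TS_idx_def l All_less_Suc le_less)
  also have "\<dots> \<longleftrightarrow> 0 < ns ! 0 \<and> ?chain \<and> ?last"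
    using pos by blast
  finally show ?thesis using len by (simp add: l)
qed (auto simp: TS_idx_def)

lemma Tn_eq_TS_sum: "Tn n l = TS_sum 0 n l"
proof -
  have "Tidx l n = TS_idx 0 l n"
    by (cases l) (simp_all add: set_eq_iff Tidx_def mem_TS_idx_iff parity_le_def)
  then show ?thesis by (simp add: Tn_def TS_sum_def parity_weight_def)
qed

lemma Sn_eq_TS_sum: "Sn n l = TS_sum 1 n l"
proof -
  have "parity_le (i + 1) x y \<longleftrightarrow> (if even i then x < y else x \<le> y)" for i x y
    by (simp add: parity_le_def)
  then have "Sidx l n = TS_idx 1 l n"
    by (cases l) (simp_all add: set_eq_iff Sidx_def mem_TS_idx_iff)
  moreover have "parity_weight (i + 1) k = (if even i then 2 * real k else 2 * real k - 1)" for i k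
    by (simp add: parity_weight_def)
  ultimately show ?thesis by (simp only: Sn_def TS_sum_def)
qed

lemma TS_idx_0: "TS_idx e 0 n = {[]}"
  by (auto simp: TS_idx_def)

lemma TS_idx_Suc:
  "TS_idx e (Suc l) n = (\<Union>m\<in>{m. 0 < m \<and> parity_le (l + e) m n}. (\<lambda>ns. ns @ [m]) ` TS_idx e l m)"
proof (intro set_eqI)
  fix xs
  have snoc_iff: "ns @ [m] \<in> TS_idx e (Suc l) n \<longleftrightarrow> 0 < m \<and> parity_le (l + e) m n \<and> ns \<in> TS_idx e l m"
    for ns m
  proof (cases "length ns = l")
    case True
    then have "(ns @ [m]) ! l = m" "((ns @ [m]) @ [n]) ! (l + 1) = n"
      "\<And>i. i < l \<Longrightarrow> (ns @ [m]) ! i = ns ! i"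
      "\<And>i. i < l \<Longrightarrow> ((ns @ [m]) @ [n]) ! (i + 1) = (ns @ [m]) ! (i + 1)"
      by (simp_all only: nth_append) simp_all
    with True show ?thesis
      unfolding TS_idx_def mem_Collect_eq All_less_Suc by auto
  qed (auto simp: TS_idx_def)
  show "xs \<in> TS_idx e (Suc l) n
      \<longleftrightarrow> xs \<in> (\<Union>m\<in>{m. 0 < m \<and> parity_le (l + e) m n}. (\<lambda>ns. ns @ [m]) ` TS_idx e l m)"
  proof (cases xs rule: rev_cases)
    case Nil
    then show ?thesis by (auto simp: TS_idx_def)
  next
    case (snoc ns m)
    then show ?thesis using snoc_iff by blast
  qed
qed

lemma finite_parity_le: "finite {m. 0 < m \<and> parity_le i m n}"
  by (rule finite_subset[of _ "{..n}"]) (auto dest: parity_le_imp_le)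

lemma finite_TS_idx: "finite (TS_idx e l n)"
  by (induction l arbitrary: n) (simp_all add: TS_idx_0 TS_idx_Suc finite_parity_le)

lemma TS_sum_Suc:
  "TS_sum e n (Suc l)
      = (\<Sum>m | 0 < m \<and> parity_le (l + e) m n. 2 / parity_weight (l + e) m * TS_sum e m l)"
proof -
  let ?M = "{m. 0 < m \<and> parity_le (l + e) m n}"
  have "TS_sum e n (Suc l)
      = (\<Sum>m\<in>?M. \<Sum>ns\<in>TS_idx e l m. 2 ^ Suc l / (\<Prod>i<Suc l. parity_weight (i + e) ((ns @ [m]) ! i)))"
    unfolding TS_sum_def TS_idx_Suc
    by (rule sum_UN_image) (auto simp: finite_parity_le finite_TS_idx inj_on_def)
  also have "\<dots> = (\<Sum>m\<in>?M. 2 / parity_weight (l + e) m * TS_sum e m l)"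
    unfolding TS_sum_def sum_distrib_left
  proof (intro sum.cong refl)
    fix m ns assume "ns \<in> TS_idx e l m"
    then have "length ns = l" by (simp add: TS_idx_def)
    moreover from this have "(\<Prod>i<l. parity_weight (i + e) ((ns @ [m]) ! i))
        = (\<Prod>i<l. parity_weight (i + e) (ns ! i))"
      by (intro prod.cong) (auto simp: nth_append)
    ultimately show "2 ^ Suc l / (\<Prod>i<Suc l. parity_weight (i + e) ((ns @ [m]) ! i))
        = 2 / parity_weight (l + e) m * (2 ^ l / (\<Prod>i<l. parity_weight (i + e) (ns ! i)))"
      by (simp add: nth_append)
  qed
  finally show ?thesis .
qed

lemma TS_sum_eq_alt_harm:
  "0 < n \<Longrightarrow> TS_sum e n l = alt_harm l (if even (l + e) then 2 * n - 1 else 2 * n)"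
proof (induction l arbitrary: n)
  case 0
  then show ?case by (simp add: TS_sum_def TS_idx_0)
next
  case (Suc l)
  show ?case
  proof (cases "even (l + e)")
    case True
    then have "{m. 0 < m \<and> parity_le (l + e) m n} = {1..n}" by (auto simp: parity_le_def)
    then show ?thesis
      unfolding TS_sum_Suc using True Suc.IH by (simp add: alt_harm_Suc_even parity_weight_def)
  next
    case False
    then have "{m. 0 < m \<and> parity_le (l + e) m n} = {1..<n}" by (auto simp: parity_le_def)
    then show ?thesis
      unfolding TS_sum_Suc using False Suc
      by (simp add: alt_harm_Suc_odd parity_weight_def del: One_nat_def)
  qed
qed

lemma Tn_eq_alt_harm: "Tn (n + 1) l = alt_harm l (if even l then 2 * n + 1 else 2 * n + 2)"
  by (simp add: Tn_eq_TS_sum TS_sum_eq_alt_harm)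

lemma Sn_eq_alt_harm: "Sn (n + 1) l = alt_harm l (if even l then 2 * n + 2 else 2 * n + 1)"
  by (simp add: Sn_eq_TS_sum TS_sum_eq_alt_harm)

section \<open>Evaluation of W\<close>

definition moment_coeff :: "nat \<Rightarrow> nat \<Rightarrow> real" where
  "moment_coeff d N = (if odd N then 2 * zetabar d else of_bool (d = 0))"

lemma moment_coeff_0: "moment_coeff 0 N = 1"
  by (simp add: moment_coeff_def zetabar_def)

lemma moment_coeff_add_2: "moment_coeff d (N + 2 + i) = moment_coeff d (N + i)"
  by (simp add: moment_coeff_def)

lemma log_moment_eq_sum_alt_harm:
  assumes "0 < q \<or> 0 < N"
  shows "log_moment q N = (\<Sum>i\<le>q. moment_coeff (q - i) (N + i) * alt_harm i N)"
  using assms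
proof (induction q arbitrary: N)
  case 0
  then show ?case by (simp add: log_moment_0 moment_coeff_0)
next
  case (Suc q)
  show ?case
  proof (induction N rule: nat_induct2)
    case 0
    show ?case by (subst sum.atMost_Suc_shift) (simp add: log_moment_at_0 moment_coeff_def)
  next
    case 1
    show ?case
      by (subst sum.atMost_Suc_shift)
         (simp add: log_moment_Suc_at_1 alt_harm_Suc_at_1 moment_coeff_def del: One_nat_def)
  next
    case (step N)
    let ?c = "\<lambda>i. moment_coeff (q - i) (N + 1 + i)"
    have split_first: "(\<Sum>i\<le>Suc q. moment_coeff (Suc q - i) (M + i) * alt_harm i M)
        = moment_coeff (Suc q) M + (\<Sum>i\<le>q. moment_coeff (q - i) (M + 1 + i) * alt_harm (Suc i) M)" for M
      by (subst sum.atMost_Suc_shift) simp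
    have "log_moment q (N + 1) = (\<Sum>i\<le>q. ?c i * alt_harm i (N + 1))"
      by (rule Suc.IH) simp
    then have "log_moment (Suc q) (N + 2)
        = moment_coeff (Suc q) N
          + (\<Sum>i\<le>q. ?c i * (alt_harm (Suc i) N + 2 / real (N + 1) * alt_harm i (N + 1)))"
      unfolding log_moment_Suc_Suc step.IH split_first
      by (simp add: sum.distrib sum_distrib_left distrib_left ac_simps)
    also have "\<dots> = moment_coeff (Suc q) (N + 2)
        + (\<Sum>i\<le>q. moment_coeff (q - i) (N + 2 + 1 + i) * alt_harm (Suc i) (N + 2))"
      using moment_coeff_add_2[of _ "N + 1"] moment_coeff_add_2[of _ N 0] by simp
    finally show ?case unfolding split_first .
  qed
qed

definition harm_pairing :: "nat \<Rightarrow> nat \<Rightarrow> real" where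
  "harm_pairing r i = (\<Sum>n. (-1) ^ n * (W_coeff r 0 n * alt_harm i (2 * n + r)))"

lemma W_coeff_times_log_moment:
  assumes "0 < r"
  shows "(-1) ^ n * (W_coeff r 0 n * log_moment q (2 * n + r))
    = (\<Sum>i\<le>q. moment_coeff (q - i) (r + i) * ((-1) ^ n * (W_coeff r 0 n * alt_harm i (2 * n + r))))"
proof -
  have "moment_coeff d (2 * n + r + i) = moment_coeff d (r + i)" for d i
    by (simp add: moment_coeff_def)
  then show ?thesis
    using assms by (simp add: log_moment_eq_sum_alt_harm sum_distrib_left ac_simps)
qed

lemma sums_harm_pairing:
  assumes "0 < r"
  shows "(\<lambda>n. (-1) ^ n * (W_coeff r 0 n * alt_harm i (2 * n + r))) sums harm_pairing r i"
proof -
  have "summable (\<lambda>n. (-1) ^ n * (W_coeff r 0 n * alt_harm i (2 * n + r)))"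
  proof (induction i rule: less_induct)
    case (less i)
    let ?a = "\<lambda>j n. (-1) ^ n * (W_coeff r 0 n * alt_harm j (2 * n + r))"
    obtain l where l: "r = Suc l" using assms by (cases r) auto
    have "summable (\<lambda>n. (-1) ^ n * (W_coeff r 0 n * log_moment i (2 * n + r)))"
      unfolding l by (rule sums_summable[OF sums_W_coeff_log_moment])
    then have "summable (\<lambda>n. (-1) ^ n * (W_coeff r 0 n * log_moment i (2 * n + r))
        - (\<Sum>j<i. moment_coeff (i - j) (r + j) * ?a j n))"
      by (intro summable_diff summable_sum summable_mult less) auto
    also have "(\<lambda>n. (-1) ^ n * (W_coeff r 0 n * log_moment i (2 * n + r))
        - (\<Sum>j<i. moment_coeff (i - j) (r + j) * ?a j n)) = ?a i"
      by (simp add: fun_eq_iff W_coeff_times_log_moment[OF assms] moment_coeff_0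
          flip: lessThan_Suc_atMost)
    finally show ?case .
  qed
  then show ?thesis unfolding harm_pairing_def by (rule summable_sums)
qed

lemma W_series_eq_sum_harm_pairing:
  assumes "0 < r"
  shows "W_series r q (-1) = (\<Sum>i\<le>q. moment_coeff (q - i) (r + i) * harm_pairing r i)"
proof -
  obtain l where l: "r = Suc l" using assms by (cases r) auto
  have "(\<lambda>n. (-1) ^ n * (W_coeff r 0 n * log_moment q (2 * n + r))) sums W_series r q (-1)"
    unfolding l by (rule sums_W_coeff_log_moment)
  moreover have "(\<lambda>n. (-1) ^ n * (W_coeff r 0 n * log_moment q (2 * n + r)))
      sums (\<Sum>i\<le>q. moment_coeff (q - i) (r + i) * harm_pairing r i)"
    unfolding W_coeff_times_log_moment[OF assms] by (intro sums_sum sums_mult sums_harm_pairing assms)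
  ultimately show ?thesis by (rule sums_unique2)
qed

lemma sum_moment_coeff:
  "(\<Sum>i\<le>q. moment_coeff (q - i) (r + i) * f i)
     = of_bool (even (r + q)) * f q + 2 * (\<Sum>i | i \<le> q \<and> odd (r + i). zetabar (q - i) * f i)"
proof -
  have "(\<Sum>i\<le>q. moment_coeff (q - i) (r + i) * f i)
      = (\<Sum>i\<le>q. (if i = q then of_bool (even (r + q)) * f q else 0)
          + (if odd (r + i) then 2 * (zetabar (q - i) * f i) else 0))"
    by (intro sum.cong) (auto simp: moment_coeff_def)
  also have "\<dots>
      = of_bool (even (r + q)) * f q + (\<Sum>i\<in>{..q} \<inter> {i. odd (r + i)}. 2 * (zetabar (q - i) * f i))"
    unfolding sum.distrib by (simp add: sum.If_cases)
  also have "{..q} \<inter> {i. odd (r + i)} = {i. i \<le> q \<and> odd (r + i)}" by auto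
  finally show ?thesis by (simp only: sum_distrib_left)
qed

lemma sum_even_indices:
  fixes f :: "nat \<Rightarrow> 'a::comm_monoid_add"
  shows "(\<Sum>i | i \<le> q \<and> even i. f i) = (\<Sum>j | 2 * j \<le> q. f (2 * j))"
  by (rule sum.reindex_bij_witness[of _ "\<lambda>j. 2 * j" "\<lambda>i. i div 2"]) auto

lemma sum_odd_indices:
  fixes f :: "nat \<Rightarrow> 'a::comm_monoid_add"
  shows "(\<Sum>i | i \<le> q \<and> odd i. f i) = (\<Sum>j | 2 * j + 1 \<le> q. f (2 * j + 1))"
  by (rule sum.reindex_bij_witness[of _ "\<lambda>j. 2 * j + 1" "\<lambda>i. i div 2"]) auto

lemma W_eq_sum_harm_pairing:
  assumes "0 < r"
  shows "W (r + q) r = (-1) ^ r * (of_bool (even (r + q)) * harm_pairing r q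
    + 2 * (\<Sum>i | i \<le> q \<and> odd (r + i). zetabar (q - i) * harm_pairing r i))"
proof -
  have "W (r + q) r = (-1) ^ r * W_series r q (-1)"
    by (simp add: W_eq_suminf[OF assms] W_series_def mult.commute)
  then show ?thesis
    unfolding W_series_eq_sum_harm_pairing[OF assms] sum_moment_coeff .
qed

text \<open>The factor \<open>alt_harm (r - 1) N\<close> of the summand vanishes for \<open>N < r\<close>, so the summation may start at the
  least positive \<open>N\<close> of the same parity as \<open>r\<close>.\<close>
lemma sums_harm_pairing_from_parity:
  assumes b: "0 < b" and r: "r = 2 * a + b"
  shows "(\<lambda>n. (-1) ^ n * (2 / real (2 * n + b) * alt_harm (r - 1) (2 * n + b) * alt_harm i (2 * n + b)))
    sums ((-1) ^ a * harm_pairing r i)"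
proof -
  let ?f = "\<lambda>n. (-1) ^ n * (2 / real (2 * n + b)
      * alt_harm (r - 1) (2 * n + b) * alt_harm i (2 * n + b))"
  have "?f (n + a) = (-1) ^ a * ((-1) ^ n * (W_coeff r 0 n * alt_harm i (2 * n + r)))" for n
  proof -
    obtain l where l: "r = Suc l" using b r by (metis add_gr_0 gr0_implies_Suc)
    have index: "2 * (n + a) + b = 2 * n + l + 1" using r l by simp
    show ?thesis
      unfolding index l W_coeff_Suc_eq_alt_harm by (simp add: power_add)
  qed
  then have "(\<lambda>n. ?f (n + a)) sums ((-1) ^ a * harm_pairing r i)"
    using b r by (simp only:) (intro sums_mult sums_harm_pairing, simp)
  moreover have "?f n = 0" if "n < a" for n
    using that b r by (subst alt_harm_eq_0) auto
  ultimately show ?thesis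
    using sums_zero_iff_shift[of a ?f] by blast
qed

lemma suminf_alt_harm_even_depth:
  assumes "0 < m"
  shows "(\<Sum>n. alt_harm (2 * m - 1) (2 * n + 2) * alt_harm i (2 * n + 2) / real (n + 1) * (-1) ^ (n + 1))
    = (-1) ^ m * harm_pairing (2 * m) i"
proof -
  have "(\<lambda>n. - ((-1) ^ n *
        (2 / real (2 * n + 2) * alt_harm (2 * m - 1) (2 * n + 2) * alt_harm i (2 * n + 2))))
      sums - ((-1) ^ (m - 1) * harm_pairing (2 * m) i)"
    by (intro sums_minus sums_harm_pairing_from_parity) (use assms in auto)
  moreover have "- ((-1) ^ n * (2 / real (2 * n + 2) * x * y)) = x * y / real (n + 1) * (-1) ^ (n + 1)"
    for n and x y :: real
    by (simp add: field_simps)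
  moreover have "- ((-1) ^ (m - 1) * x) = (-1) ^ m * x" for x :: real
    using assms by (cases m) auto
  ultimately show ?thesis by (simp only: sums_iff)
qed

lemma suminf_alt_harm_odd_depth:
  assumes "0 < m"
  shows "(\<Sum>n. alt_harm (2 * m - 2) (2 * n + 1) * alt_harm i (2 * n + 1)
      / (2 * real (n + 1) - 1) * (-1) ^ (n + 1))
    = (-1) ^ m / 2 * harm_pairing (2 * m - 1) i"
proof -
  have depth: "2 * m - 1 - 1 = 2 * m - 2" by simp
  have "(\<lambda>n. - (1 / 2) * ((-1) ^ n *
        (2 / real (2 * n + 1) * alt_harm (2 * m - 1 - 1) (2 * n + 1) * alt_harm i (2 * n + 1))))
      sums (- (1 / 2) * ((-1) ^ (m - 1) * harm_pairing (2 * m - 1) i))"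
    by (intro sums_mult sums_harm_pairing_from_parity) (use assms in auto)
  moreover have "- (1 / 2) * ((-1) ^ n * (2 / real (2 * n + 1) * x * y))
      = x * y / (2 * real (n + 1) - 1) * (-1) ^ (n + 1)" for n and x y :: real
    by (simp add: field_simps)
  moreover have "- (1 / 2) * ((-1) ^ (m - 1) * x) = (-1) ^ m / 2 * x" for x :: real
    using assms by (cases m) auto
  ultimately show ?thesis by (simp only: sums_iff depth)
qed

lemma W_even_depth:
  assumes "0 < m"
  shows "W (2 * m + q) (2 * m)
    = 2 * (-1) ^ m * (\<Sum>j | 2 * j + 1 \<le> q. zetabar (q - (2 * j + 1)) *
        (\<Sum>n. Tn (n + 1) (2 * m - 1) * Tn (n + 1) (2 * j + 1) / real (n + 1) * (-1) ^ (n + 1)))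
      + of_bool (even q) * ((-1) ^ m *
        (\<Sum>n. Tn (n + 1) (2 * m - 1) * Sn (n + 1) q / real (n + 1) * (-1) ^ (n + 1)))"
proof -
  have odd: "odd (2 * m - 1)" "odd (2 * j + 1)" for j using assms by auto
  have Tn_Tn: "(\<Sum>n. Tn (n + 1) (2 * m - 1) * Tn (n + 1) (2 * j + 1) / real (n + 1) * (-1) ^ (n + 1))
      = (-1) ^ m * harm_pairing (2 * m) (2 * j + 1)" for j
    by (simp only: Tn_eq_alt_harm odd if_False suminf_alt_harm_even_depth[OF assms])
  have Tn_Sn: "(\<Sum>n. Tn (n + 1) (2 * m - 1) * Sn (n + 1) q / real (n + 1) * (-1) ^ (n + 1))
      = (-1) ^ m * harm_pairing (2 * m) q" if "even q"
    by (simp only: Tn_eq_alt_harm Sn_eq_alt_harm odd that if_True if_False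
        suminf_alt_harm_even_depth[OF assms])
  have "W (2 * m + q) (2 * m) = of_bool (even q) * harm_pairing (2 * m) q
      + 2 * (\<Sum>j | 2 * j + 1 \<le> q. zetabar (q - (2 * j + 1)) * harm_pairing (2 * m) (2 * j + 1))"
    using W_eq_sum_harm_pairing[of "2 * m" q] assms by (simp add: sum_odd_indices)
  moreover have sign: "2 * (-1) ^ m * (z * ((-1) ^ m * h)) = 2 * (z * h)"
    "(-1) ^ m * ((-1) ^ m * h) = h"
    for z h :: real
    by (simp_all add: minus_one_power_iff)
  ultimately show ?thesis
    unfolding Tn_Tn sum_distrib_left sign by (cases "even q") (simp_all only: Tn_Sn sign, simp_all)
qed

lemma W_odd_depth:
  assumes "0 < m"
  shows "W (2 * m - 1 + q) (2 * m - 1)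
    = 4 * (-1) ^ (m - 1) * (\<Sum>j | 2 * j \<le> q. zetabar (q - 2 * j) *
        (\<Sum>n. Tn (n + 1) (2 * m - 2) * Tn (n + 1) (2 * j) / (2 * real (n + 1) - 1) * (-1) ^ (n + 1)))
      + of_bool (odd q) * (2 * (-1) ^ (m - 1) *
        (\<Sum>n. Tn (n + 1) (2 * m - 2) * Sn (n + 1) q / (2 * real (n + 1) - 1) * (-1) ^ (n + 1)))"
proof -
  have odd: "odd (2 * m - 1)" and even: "even (2 * m - 2)" "even (2 * j)" for j using assms by auto
  have Tn_Tn: "(\<Sum>n. Tn (n + 1) (2 * m - 2) * Tn (n + 1) (2 * j) / (2 * real (n + 1) - 1) * (-1) ^ (n + 1))
      = (-1) ^ m / 2 * harm_pairing (2 * m - 1) (2 * j)" for j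
    by (simp only: Tn_eq_alt_harm even if_True suminf_alt_harm_odd_depth[OF assms])
  have Tn_Sn: "(\<Sum>n. Tn (n + 1) (2 * m - 2) * Sn (n + 1) q / (2 * real (n + 1) - 1) * (-1) ^ (n + 1))
      = (-1) ^ m / 2 * harm_pairing (2 * m - 1) q" if "odd q"
    by (simp only: Tn_eq_alt_harm Sn_eq_alt_harm even that if_True if_False
        suminf_alt_harm_odd_depth[OF assms])
  have "W (2 * m - 1 + q) (2 * m - 1) = - (of_bool (odd q) * harm_pairing (2 * m - 1) q
      + 2 * (\<Sum>j | 2 * j \<le> q. zetabar (q - 2 * j) * harm_pairing (2 * m - 1) (2 * j)))"
    using W_eq_sum_harm_pairing[of "2 * m - 1" q] assms odd by (simp add: sum_even_indices)
  moreover have sign: "4 * (-1) ^ (m - 1) * (z * ((-1) ^ m / 2 * h)) = - (2 * (z * h))"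
    "2 * (-1) ^ (m - 1) * ((-1) ^ m / 2 * h) = - h" for z h :: real
    using assms by (cases m; simp add: minus_one_power_iff)+
  ultimately show ?thesis
    unfolding Tn_Tn sum_distrib_left sign
    by (cases "odd q") (simp_all only: Tn_Sn sign not_False_eq_True, simp_all add: sum_negf)
qed

theorem mainTheorem4:
  fixes m p :: nat
  assumes "1 \<le> m" and "1 \<le> p"
  shows
   "W (2*p + 2*m - 1) (2*m) =
      2 * (-1) ^ m * (\<Sum>j = 0..p-1. zetabar (2*p - 2 - 2*j) *
        (\<Sum>n. Tn (n+1) (2*m - 1) * Tn (n+1) (2*j + 1) / real (n+1) * (-1) ^ (n+1))) \<and>
    W (2*p + 2*m - 2) (2*m) =
      2 * (-1) ^ m * (\<Sum>j \<in> {j. j + 2 \<le> p}. zetabar (2*p - 3 - 2*j) *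
        (\<Sum>n. Tn (n+1) (2*m - 1) * Tn (n+1) (2*j + 1) / real (n+1) * (-1) ^ (n+1)))
      + (-1) ^ m * (\<Sum>n. Tn (n+1) (2*m - 1) * Sn (n+1) (2*p - 2) / real (n+1) * (-1) ^ (n+1)) \<and>
    W (2*p + 2*m - 2) (2*m - 1) =
      4 * (-1) ^ (m - 1) * (\<Sum>j = 0..p-1. zetabar (2*p - 1 - 2*j) *
        (\<Sum>n. Tn (n+1) (2*m - 2) * Tn (n+1) (2*j) / (2 * real (n+1) - 1) * (-1) ^ (n+1)))
      + 2 * (-1) ^ (m - 1) * (\<Sum>n. Tn (n+1) (2*m - 2) * Sn (n+1) (2*p - 1) / (2 * real (n+1) - 1) * (-1) ^ (n+1)) \<and>
    W (2*p + 2*m - 3) (2*m - 1) =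
      4 * (-1) ^ (m - 1) * (\<Sum>j = 0..p-1. zetabar (2*p - 2 - 2*j) *
        (\<Sum>n. Tn (n+1) (2*m - 2) * Tn (n+1) (2*j) / (2 * real (n+1) - 1) * (-1) ^ (n+1)))"
proof -
  have m: "0 < m" using assms by simp
  have differences: "2*p - 1 - (2*j + 1) = 2*p - 2 - 2*j" "2*p - 2 - (2*j + 1) = 2*p - 3 - 2*j" for j
    by auto
  have parities: "odd (2*p - 1)" "even (2*p - 2)" using assms by auto
  show ?thesis
  proof (intro conjI, goal_cases)
    case 1
    have "2*p + 2*m - 1 = 2*m + (2*p - 1)" "{0..p-1} = {j. 2*j + 1 \<le> 2*p - 1}" using assms by auto
    then show ?case
      using W_even_depth[OF m, of "2*p - 1"] parities by (simp only: differences) simp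
  next
    case 2
    have "2*p + 2*m - 2 = 2*m + (2*p - 2)" "{j. j + 2 \<le> p} = {j. 2*j + 1 \<le> 2*p - 2}" using assms by auto
    then show ?case
      using W_even_depth[OF m, of "2*p - 2"] parities by (simp only: differences) simp
  next
    case 3
    have "2*p + 2*m - 2 = 2*m - 1 + (2*p - 1)" "{0..p-1} = {j. 2*j \<le> 2*p - 1}" using assms by auto
    then show ?case
      using W_odd_depth[OF m, of "2*p - 1"] parities by (simp only:) simp
  next
    case 4
    have "2*p + 2*m - 3 = 2*m - 1 + (2*p - 2)" "{0..p-1} = {j. 2*j \<le> 2*p - 2}" using assms by auto
    then show ?case
      using W_odd_depth[OF m, of "2*p - 2"] parities by (simp only:) simp
  qed
qed

end
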